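(* Under the standing assumptions below, the canonical semimartingale decomposition of $\zeta$ in its filtration $\mathbb F^{\zeta,c}$ is $$\zeta_t=\widetilde N_t+\int_0^t(1-\zeta_s)\int_{(s,+\infty)}\frac{1}{r-s}\,\phi_s^r(\zeta_s)\,\mathbb P_\tau(dr)\,\mathbb I_{\{0<\zeta_s<1\}}\,ds,\qquad t\ge0,$$ where $(\widetilde N_t,t\ge0)$ is an $\mathbb F^{\zeta,c}$-martingale stopped at $\tau$.
   Context: $\gamma$ a standard gamma process (driftless subordinator, $\gamma_0=0$, càdlàg, $\mathbb E[e^{-\lambda\gamma_t}]=(1+\lambda)^{-t}$) on a complete probability space $(\Omega,\mathcal F,\mathbb P)$ with null sets $\mathcal N_P$; $\tau:\Omega\to(0,\infty)$ a random variable independent of $\gamma$, with law $\mathbb P_\tau$; $\zeta_t=\gamma_{t\wedge\tau}/\gamma_\tau$; $\mathcal F^{\zeta,c}_t=\sigma(\zeta_s,s\le t)\vee\mathcal N_P$. For $0<s<r$, $\phi_s^r(x)=\dfrac{(1-x)^r\,\Gamma(r)/\Gamma(r-s)}{\int_{(s,+\infty)}(1-x)^v\,\Gamma(v)/\Gamma(v-s)\,\mathbb P_\tau(dv)}\,\mathbb I_{(0,1)}(x)$. *)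

theory Defs
  imports "HOL-Probability.Probability"
begin

definition standard_gamma_process :: "'a measure \<Rightarrow> (real \<Rightarrow> 'a \<Rightarrow> real) \<Rightarrow> bool" where
  "standard_gamma_process M g \<longleftrightarrow>
     (\<forall>t\<ge>0. g t \<in> borel_measurable M) \<and>
     (\<forall>\<omega>\<in>space M. g 0 \<omega> = 0) \<and>
     (\<forall>\<omega>\<in>space M. \<forall>t\<ge>0. continuous (at_right t) (\<lambda>s. g s \<omega>) \<and>
        (t > 0 \<longrightarrow> (\<exists>l. ((\<lambda>s. g s \<omega>) \<longlongrightarrow> l) (at_left t)))) \<and>
     (\<forall>(n::nat) (ts::nat \<Rightarrow> real). 0 \<le> ts 0 \<longrightarrow> (\<forall>i<n. ts i < ts (Suc i)) \<longrightarrow>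
        prob_space.indep_vars M (\<lambda>_. borel) (\<lambda>i \<omega>. g (ts (Suc i)) \<omega> - g (ts i) \<omega>) {..<n}) \<and>
     (\<forall>s t l::real. 0 \<le> s \<longrightarrow> s \<le> t \<longrightarrow> 0 \<le> l \<longrightarrow>
        (\<integral>\<omega>. exp (- l * (g t \<omega> - g s \<omega>)) \<partial>M) = (1 + l) powr (- (t - s)))"

definition zeta :: "(real \<Rightarrow> 'a \<Rightarrow> real) \<Rightarrow> ('a \<Rightarrow> real) \<Rightarrow> real \<Rightarrow> 'a \<Rightarrow> real" where
  "zeta g \<tau> t \<omega> = g (min t (\<tau> \<omega>)) \<omega> / g (\<tau> \<omega>) \<omega>"

definition compl_nat_filtration :: "'a measure \<Rightarrow> (real \<Rightarrow> 'a \<Rightarrow> real) \<Rightarrow> real \<Rightarrow> 'a set set" where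
  "compl_nat_filtration M X t = sigma_sets (space M)
     ((\<Union>s\<in>{0..t}. {X s -` B \<inter> space M | B. B \<in> sets borel}) \<union> null_sets M)"

definition martingale_wrt :: "'a measure \<Rightarrow> (real \<Rightarrow> 'a set set) \<Rightarrow> (real \<Rightarrow> 'a \<Rightarrow> real) \<Rightarrow> bool" where
  "martingale_wrt M F X \<longleftrightarrow>
     (\<forall>t\<ge>0. integrable M (X t) \<and> (\<forall>B\<in>sets borel. X t -` B \<inter> space M \<in> F t)) \<and>
     (\<forall>s t. 0 \<le> s \<longrightarrow> s \<le> t \<longrightarrow> (\<forall>A\<in>F s. (\<integral>\<omega>\<in>A. X t \<omega> \<partial>M) = (\<integral>\<omega>\<in>A. X s \<omega> \<partial>M)))"

text \<open>phi_s^r(x), for 0 < s < r, with Ptau the law of tau.\<close>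
definition phi :: "real measure \<Rightarrow> real \<Rightarrow> real \<Rightarrow> real \<Rightarrow> real" where
  "phi Ptau s r x = (if 0 < x \<and> x < 1 then
      ((1 - x) powr r * Gamma r / Gamma (r - s)) /
      (\<integral>v\<in>{s<..}. (1 - x) powr v * Gamma v / Gamma (v - s) \<partial>Ptau)
    else 0)"

definition inner_integrand :: "real measure \<Rightarrow> real \<Rightarrow> real \<Rightarrow> real \<Rightarrow> real" where
  "inner_integrand Ptau s x r = 1 / (r - s) * phi Ptau s r x"

definition drift :: "real measure \<Rightarrow> (real \<Rightarrow> 'a \<Rightarrow> real) \<Rightarrow> real \<Rightarrow> 'a \<Rightarrow> real" where
  "drift Ptau Z s \<omega> = (1 - Z s \<omega>) * (\<integral>r\<in>{s<..}. inner_integrand Ptau s (Z s \<omega>) r \<partial>Ptau)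
      * indicator {x. 0 < x \<and> x < 1} (Z s \<omega>)"

end

theory Submission
  imports Defs
begin

text \<open>
  Write \<open>\<gamma>\<close> for the gamma process. Scaling a gamma process by \<open>1 / w\<close> changes its law up to time \<open>u\<close> by the
  density \<open>w powr u * exp ((1 - w) * \<gamma>\<^sub>u)\<close>; integrating over the value \<open>w\<close> of \<open>\<gamma>\<^sub>r\<close> shows that the bridge
  \<open>\<gamma> / \<gamma>\<^sub>r\<close> has, up to time \<open>u < r\<close>, a density with respect to \<open>\<gamma>\<close> that depends on \<open>\<gamma>\<^sub>u\<close> only. Since \<open>\<tau>\<close> is
  independent of \<open>\<gamma>\<close>, Bayes' rule with these densities identifies the drift at time \<open>u\<close> as the
  conditional expectation of \<open>(1 - \<zeta>\<^sub>u) / (\<tau> - u)\<close> on \<open>u < \<tau>\<close>. A Beta integral gives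
  \<open>E [1 - \<zeta>\<^sub>u | \<zeta>\<^sub>v, v \<le> s] = (1 - \<zeta>\<^sub>s) (r - u) / (r - s)\<close> for the bridge of fixed length \<open>r\<close>, so that both
  \<open>\<zeta>\<^sub>t - \<zeta>\<^sub>s\<close> and the integrated drift have the same expectation as \<open>(1 - \<zeta>\<^sub>s) (min t \<tau> - s) / (\<tau> - s)\<close> on
  cylinder sets of the past at time \<open>s\<close>.
\<close>

section \<open>The gamma distribution and its Laplace transform\<close>

text \<open>No conditional law or conditional expectation is ever formed. All identities are between
  integrals with values in the extended nonnegative reals, and a statement about the past at time s
  is tested against functions \<open>h\<close> of the increments of \<zeta> over a partition ending
  at s. The increments of \<gamma> are independent gamma variables, so their joint law is an
  explicit product.

  Working with 1 - \<zeta> instead of \<zeta> gives a compensation identity between nonnegative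
  quantities, which makes sense beforehand; at s = 0 it bounds the expected integrated drift by 1,
  and integrability follows.

  The process is specified through independence and Laplace transforms of its increments, so their
  sign and law have to be recovered first. Order relations between values of \<gamma> are available
  only almost surely at fixed times; at the random time \<tau> they are obtained by freezing \<tau>,
  which requires joint measurability in time and \<omega>.\<close>

lemma borel_measurable_Gamma [measurable]: "(Gamma :: real \<Rightarrow> real) \<in> borel_measurable borel"
proof -
  \<comment> \<open>\<open>Gamma\<close> is discontinuous at its poles, while its reciprocal
    \<open>rGamma\<close> is continuous everywhere. At the poles both sides take the default value
    0.\<close>
  have eq: "(Gamma :: real \<Rightarrow> real) = (\<lambda>x. inverse (rGamma x))"
    by (simp add: rGamma_inverse_Gamma fun_eq_iff)
  have "(rGamma :: real \<Rightarrow> real) \<in> borel_measurable borel"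
    by (intro borel_measurable_continuous_onI continuous_on_rGamma)
  then show ?thesis by (subst eq) (rule borel_measurable_inverse)
qed

definition gamma_density :: "real \<Rightarrow> real \<Rightarrow> real" where
  "gamma_density a x = (if 0 < x then x powr (a - 1) * exp (- x) / Gamma a else 0)"

lemma borel_measurable_gamma_density [measurable]:
  "gamma_density a \<in> borel_measurable borel"
  unfolding gamma_density_def by measurable

lemma gamma_density_nonneg: "0 < a \<Longrightarrow> 0 \<le> gamma_density a x"
  by (simp add: gamma_density_def Gamma_real_pos less_imp_le)

lemma nn_integral_Gamma_scaled:
  assumes a: "0 < a" and c: "0 < c"
  shows "(\<integral>\<^sup>+x. ennreal (if 0 < x then x powr (a - 1) * exp (- c * x) else 0) \<partial>lborel)
    = ennreal (Gamma a * c powr (- a))"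
proof -
  let ?f = "\<lambda>x. ennreal (if 0 < x then x powr (a - 1) * exp (- x) else 0)"
  have "ennreal (Gamma a) = (\<integral>\<^sup>+x. ?f x \<partial>lborel)"
    unfolding Gamma_conv_nn_integral_real[OF a]
    by (intro nn_integral_cong) (auto simp: indicator_def exp_minus field_simps)
  also have "\<dots> = \<bar>c\<bar> * (\<integral>\<^sup>+x. ?f (0 + c * x) \<partial>lborel)"
    using c by (intro nn_integral_real_affine) auto
  also have "(\<integral>\<^sup>+x. ?f (0 + c * x) \<partial>lborel)
      = (\<integral>\<^sup>+x. c powr (a - 1) * ennreal (if 0 < x then x powr (a - 1) * exp (- c * x) else 0) \<partial>lborel)"
    using c by (intro nn_integral_cong)
      (auto simp: powr_mult zero_less_mult_iff ennreal_mult[symmetric] mult.assoc)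
  also have "\<dots> = c powr (a - 1) * (\<integral>\<^sup>+x. ennreal (if 0 < x then x powr (a - 1) * exp (- c * x) else 0) \<partial>lborel)"
    by (intro nn_integral_cmult) auto
  finally have *: "ennreal (Gamma a) = ennreal (c powr a) * (\<integral>\<^sup>+x. ennreal (if 0 < x then x powr (a - 1) * exp (- c * x) else 0) \<partial>lborel)"
    using c by (simp add: mult.assoc[symmetric] ennreal_mult[symmetric] powr_diff)
  have "ennreal (c powr (- a)) * ennreal (Gamma a)
      = (\<integral>\<^sup>+x. ennreal (if 0 < x then x powr (a - 1) * exp (- c * x) else 0) \<partial>lborel)"
    unfolding * mult.assoc[symmetric] using c
    by (simp add: ennreal_mult[symmetric] powr_minus)
  then show ?thesis using a by (simp add: ennreal_mult[symmetric] mult.commute)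
qed

lemma nn_integral_exp_gamma_density:
  assumes "0 < a" "0 \<le> l"
  shows "(\<integral>\<^sup>+x. ennreal (exp (- l * x)) * ennreal (gamma_density a x) \<partial>lborel) = ennreal ((1 + l) powr (- a))"
proof -
  have "(\<integral>\<^sup>+x. ennreal (exp (- l * x)) * ennreal (gamma_density a x) \<partial>lborel)
     = (\<integral>\<^sup>+x. ennreal (1 / Gamma a) * ennreal (if 0 < x then x powr (a - 1) * exp (- (1 + l) * x) else 0) \<partial>lborel)"
    using assms
    by (intro nn_integral_cong)
      (auto simp: gamma_density_def ennreal_mult[symmetric] exp_add exp_diff exp_minus field_simps)
  also have "\<dots> = ennreal (1 / Gamma a) * ennreal (Gamma a * (1 + l) powr (- a))"
    using assms by (subst nn_integral_cmult) (auto simp: nn_integral_Gamma_scaled)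
  also have "\<dots> = ennreal ((1 + l) powr (- a))"
    using Gamma_real_pos[of a] assms by (simp add: ennreal_mult[symmetric] less_imp_neq[THEN not_sym])
  finally show ?thesis .
qed

definition gamma_dist :: "real \<Rightarrow> real measure" where
  "gamma_dist a = density lborel (\<lambda>x. ennreal (gamma_density a x))"

lemma sets_gamma_dist [measurable_cong, simp]: "sets (gamma_dist a) = sets borel"
  and space_gamma_dist [simp]: "space (gamma_dist a) = UNIV"
  by (simp_all add: gamma_dist_def)

lemma prob_space_gamma_dist: "0 < a \<Longrightarrow> prob_space (gamma_dist a)"
  using nn_integral_exp_gamma_density[of a 0]
  by (intro prob_spaceI) (simp add: gamma_dist_def emeasure_density)

lemma AE_gamma_dist_pos: "AE x in gamma_dist a. 0 < x"
  unfolding gamma_dist_def by (subst AE_density) (auto simp: gamma_density_def)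

section \<open>Laplace transforms determine laws on the half-line\<close>

text \<open>Expand the exponential and integrate term by term: since the support lies in [0, 1], the
  n-th term is dominated by \<open>\<bar>t\<bar> ^ n / fact n\<close>, which is summable.\<close>

lemma char_eq_suminf_moments:
  assumes "real_distribution N" and bnd: "AE x in N. 0 \<le> x \<and> x \<le> 1"
  shows "char N t = (\<Sum>n. (\<i> * t) ^ n / fact n * complex_of_real (\<integral>x. x ^ n \<partial>N))"
proof -
  interpret real_distribution N by fact
  have bp: "AE x in N. \<bar>x ^ n\<bar> \<le> 1" for n
    using bnd by eventually_elim (simp add: power_le_one)
  have int: "integrable N (\<lambda>x. x ^ n)" for n
    using bp by (intro integrable_const_bound[where B=1]) auto
  let ?f = "\<lambda>n x. (\<i> * t) ^ n / fact n * complex_of_real (x ^ n)"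
  have sums: "(\<lambda>n. ?f n x) sums iexp (t * x)" for x
    using exp_converges[of "\<i> * complex_of_real (t * x)"]
    by (simp add: scaleR_conv_of_real power_mult_distrib field_simps)
  have nrm: "norm (?f n x) = \<bar>t\<bar> ^ n / fact n * \<bar>x ^ n\<bar>" for n x
    by (simp add: norm_mult norm_divide norm_power power_abs)
  have "char N t = (\<integral>x. (\<Sum>n. ?f n x) \<partial>N)"
    unfolding char_def using sums_unique[OF sums] by simp
  also have "\<dots> = (\<Sum>n. (\<integral>x. ?f n x \<partial>N))"
  proof (rule integral_suminf)
    show "integrable N (?f n)" for n
      by (intro integrable_mult_right integrable_of_real int)
    have summ: "summable (\<lambda>n. \<bar>t\<bar> ^ n / fact n)"
      using summable_exp[of "\<bar>t\<bar>"] by (simp add: field_simps)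
    have "AE x in N. \<forall>n. \<bar>x ^ n\<bar> \<le> 1" using bp by (simp add: AE_all_countable)
    then show "AE x in N. summable (\<lambda>n. norm (?f n x))"
    proof eventually_elim
      case (elim x)
      show ?case unfolding nrm
        by (rule summable_comparison_test'[OF summ, of 0])
          (use elim in \<open>auto simp: abs_mult divide_right_mono mult_left_le\<close>)
    qed
    show "summable (\<lambda>n. \<integral>x. norm (?f n x) \<partial>N)"
    proof (rule summable_comparison_test'[OF summ, of 0])
      fix n
      have "(\<integral>x. norm (?f n x) \<partial>N) \<le> (\<integral>x. \<bar>t\<bar> ^ n / fact n \<partial>N)"
        unfolding nrm using bp[of n] int[of n]
        by (intro integral_mono_AE) (auto elim!: eventually_mono intro!: divide_right_mono mult_left_le)
      then show "norm (\<integral>x. norm (?f n x) \<partial>N) \<le> \<bar>t\<bar> ^ n / fact n"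
        using prob_space by simp
    qed
  qed
  also have "\<dots> = (\<Sum>n. (\<i> * t) ^ n / fact n * complex_of_real (\<integral>x. x ^ n \<partial>N))"
    by (intro suminf_cong) (simp only: integral_mult_right_zero integral_complex_of_real)
  finally show ?thesis .
qed

text \<open>The Laplace transform at the naturals gives the moments of \<open>exp (- X)\<close>, which is bounded, so that
  they determine its characteristic function.\<close>
lemma distr_eq_if_Laplace_eq:
  assumes "prob_space M1" "prob_space M2" and sets: "sets M1 = sets borel" "sets M2 = sets borel"
    and pos: "AE x in M1. (0::real) \<le> x" "AE x in M2. 0 \<le> x"
    and eq: "\<And>n::nat. (\<integral>x. exp (- real n * x) \<partial>M1) = (\<integral>x. exp (- real n * x) \<partial>M2)"
  shows "M1 = M2"
proof -
  interpret M1: prob_space M1 by fact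
  interpret M2: prob_space M2 by fact
  have [measurable_cong]: "sets M1 = sets borel" "sets M2 = sets borel" by fact+
  let ?e = "\<lambda>x::real. exp (- x)"
  have d: "real_distribution (distr M1 borel ?e)" "real_distribution (distr M2 borel ?e)"
    by (auto intro!: M1.real_distribution_distr M2.real_distribution_distr)
  have "AE x in distr M1 borel ?e. 0 \<le> x \<and> x \<le> 1" "AE x in distr M2 borel ?e. 0 \<le> x \<and> x \<le> 1"
    using pos by (subst AE_distr_iff; auto elim!: eventually_mono)+
  note ch = this[THEN char_eq_suminf_moments[rotated]]
  have mom: "(\<integral>x. x ^ n \<partial>distr M1 borel ?e) = (\<integral>x. x ^ n \<partial>distr M2 borel ?e)" for n
    using eq[of n] by (simp add: integral_distr exp_of_nat_mult[symmetric])
  have "char (distr M1 borel ?e) = char (distr M2 borel ?e)"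
    by (rule ext) (simp add: ch d mom)
  then have "distr M1 borel ?e = distr M2 borel ?e"
    using d by (intro Levy_uniqueness)
  \<comment> \<open>\<open>- ln x\<close> inverts \<open>exp (- x)\<close>, so the original laws are
    recovered from the transformed ones.\<close>
  then have "distr (distr M1 borel ?e) borel (\<lambda>x. - ln x) = distr (distr M2 borel ?e) borel (\<lambda>x. - ln x)"
    by simp
  then have "distr M1 borel (\<lambda>x. x) = distr M2 borel (\<lambda>x. x)"
    by (subst (asm) (1 2) distr_distr) (auto simp: comp_def)
  moreover have "distr M1 borel (\<lambda>x. x) = M1" "distr M2 borel (\<lambda>x. x) = M2"
    using sets by (auto intro!: distr_id2)
  ultimately show ?thesis by simp
qed

text \<open>If \<open>X < - d\<close> had positive probability p, the inequality
  \<open>exp y \<ge> 1 + y\<close> would force the transform at n to be at least p (1 + n d), which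
  is unbounded in n. This supplies the sign of the increments, without which the uniqueness of
  Laplace transforms could not be applied.\<close>

lemma (in prob_space) AE_nonneg_if_Laplace_bounded:
  assumes [measurable]: "X \<in> borel_measurable M"
    and int: "\<And>n::nat. integrable M (\<lambda>\<omega>. exp (- real n * X \<omega>))"
    and bnd: "\<And>n::nat. (\<integral>\<omega>. exp (- real n * X \<omega>) \<partial>M) \<le> 1"
  shows "AE \<omega> in M. (0::real) \<le> X \<omega>"
proof -
  have "AE \<omega> in M. - 1 / real (Suc k) \<le> X \<omega>" for k
  proof -
    define d where "d = 1 / real (Suc k)"
    have d: "0 < d" by (simp add: d_def)
    let ?A = "{\<omega>\<in>space M. X \<omega> < - d}"
    have le: "prob ?A * (1 + real n * d) \<le> 1" for n
    proof -
      have "prob ?A * (1 + real n * d) \<le> (\<integral>\<omega>. exp (- real n * X \<omega>) \<partial>M)"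
      proof -
        have "prob ?A * (1 + real n * d) = (\<integral>\<omega>. indicator ?A \<omega> * (1 + real n * d) \<partial>M)"
          by simp
        also have "\<dots> \<le> (\<integral>\<omega>. exp (- real n * X \<omega>) \<partial>M)"
        proof (intro integral_mono int)
          fix \<omega> assume "\<omega> \<in> space M"
          show "indicator ?A \<omega> * (1 + real n * d) \<le> exp (- real n * X \<omega>)"
          proof (cases "\<omega> \<in> ?A")
            case True
            then have "real n * d \<le> - real n * X \<omega>"
              using mult_left_mono[of d "- X \<omega>" "real n"] by auto
            then have "1 + real n * d \<le> 1 + (- real n * X \<omega>)" by simp
            also have "\<dots> \<le> exp (- real n * X \<omega>)" by (rule exp_ge_add_one_self)
            finally show ?thesis using True by simp
          qed simp
        qed (simp add: integrable_mult_left integrable_indicator_iff less_top[symmetric])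
        finally show ?thesis .
      qed
      also have "\<dots> \<le> 1" by (rule bnd)
      finally show ?thesis .
    qed
    have "prob ?A = 0"
    proof (rule ccontr)
      assume "prob ?A \<noteq> 0"
      then have p: "0 < prob ?A * d" using d by (simp add: zero_less_measure_iff)
      obtain n where "1 < real n * (prob ?A * d)"
        using reals_Archimedean3[OF p] by blast
      moreover have "prob ?A * (1 + real n * d) = prob ?A + real n * (prob ?A * d)"
        by (simp add: algebra_simps)
      ultimately show False using le[of n] measure_nonneg[of M ?A] by linarith
    qed
    then have "AE \<omega> in M. \<not> (X \<omega> < - d)"
      by (subst AE_iff_measurable[of ?A]) (auto simp: emeasure_eq_measure)
    then show ?thesis by (auto simp: d_def not_less)
  qed
  then have "AE \<omega> in M. \<forall>k. - 1 / real (Suc k) \<le> X \<omega>"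
    by (simp add: AE_all_countable)
  then show ?thesis
  proof eventually_elim
    case (elim \<omega>)
    show ?case
    proof (rule ccontr)
      assume "\<not> 0 \<le> X \<omega>"
      then obtain k where "1 / real (Suc k) < - X \<omega>"
        using reals_Archimedean[of "- X \<omega>"] by (auto simp: inverse_eq_divide)
      then show False using elim[rule_format, of k] by simp
    qed
  qed
qed

lemma (in prob_space) distr_eq_gamma_dist_if_Laplace:
  assumes [measurable]: "X \<in> borel_measurable M" and a: "0 < a"
    and L: "\<And>l. 0 \<le> l \<Longrightarrow> (\<integral>\<omega>. exp (- l * X \<omega>) \<partial>M) = (1 + l) powr (- a)"
  shows "distr M borel X = gamma_dist a"
proof -
  \<comment> \<open>The integral of a non-integrable function is 0 by convention, whereas
    \<open>L\<close> assigns it a positive value; so the Laplace formula already contains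
    integrability.\<close>
  have int: "integrable M (\<lambda>\<omega>. exp (- real n * X \<omega>))" for n
  proof (rule ccontr)
    assume "\<not> ?thesis"
    then have "(\<integral>\<omega>. exp (- real n * X \<omega>) \<partial>M) = 0" by (rule not_integrable_integral_eq)
    then show False using L[of "real n"] by simp
  qed
  have "(1 + real n) powr (- a) \<le> 1" for n
    using a by (simp add: powr_minus_divide ge_one_powr_ge_zero)
  then have pos: "AE \<omega> in M. 0 \<le> X \<omega>"
    using L by (intro AE_nonneg_if_Laplace_bounded int) auto
  interpret G: prob_space "gamma_dist a" by (rule prob_space_gamma_dist[OF a])
  show ?thesis
  proof (rule distr_eq_if_Laplace_eq)
    show "prob_space (distr M borel X)" by (simp add: prob_space_distr)
    show "AE x in distr M borel X. 0 \<le> x" using pos by (subst AE_distr_iff) auto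
    show "AE x in gamma_dist a. 0 \<le> x" using AE_gamma_dist_pos[of a] by eventually_elim simp
    fix n
    have "(\<integral>x. exp (- real n * x) \<partial>gamma_dist a) = (1 + real n) powr (- a)"
    proof (intro integral_eq_nn_integral[THEN trans])
      have "(\<integral>\<^sup>+x. ennreal (exp (- real n * x)) \<partial>gamma_dist a) = ennreal ((1 + real n) powr (- a))"
        using nn_integral_exp_gamma_density[OF a, of "real n"]
        by (simp add: gamma_dist_def nn_integral_density mult.commute)
      then show "enn2real (\<integral>\<^sup>+x. ennreal (exp (- real n * x)) \<partial>gamma_dist a) = (1 + real n) powr (- a)"
        by simp
    qed auto
    then show "(\<integral>x. exp (- real n * x) \<partial>distr M borel X) = (\<integral>x. exp (- real n * x) \<partial>gamma_dist a)"
      using L[of "real n"] by (simp add: integral_distr)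
  qed (auto simp: prob_space_gamma_dist a)
qed

section \<open>Joint measurability of right-continuous processes\<close>

text \<open>Both \<gamma> and \<zeta> are evaluated at random times and integrated over time, so
  measurability at each fixed time is not enough. Right-continuity makes the process a limit of
  processes that are piecewise constant in time.\<close>

lemma right_continuous_jointly_measurable:
  fixes X :: "real \<Rightarrow> 'a \<Rightarrow> real"
  assumes X[measurable]: "\<And>s. 0 \<le> s \<Longrightarrow> X s \<in> borel_measurable M"
    and rc: "\<And>\<omega> s. \<omega> \<in> space M \<Longrightarrow> 0 \<le> s \<Longrightarrow> continuous (at_right s) (\<lambda>s. X s \<omega>)"
  shows "(\<lambda>(s, \<omega>). X (max 0 s) \<omega>) \<in> borel_measurable (borel \<Otimes>\<^sub>M M)"
proof -
  \<comment> \<open>The grid point of mesh 1 / (n + 1) strictly to the right of s. The added 1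
    matters: the limit along \<open>at_right\<close> excludes s itself.\<close>
  define q where "q n s = (real_of_int \<lfloor>real (Suc n) * max 0 s\<rfloor> + 1) / real (Suc n)" for n s
  have "(\<lambda>p. X (max 0 (fst p)) (snd p)) \<in> borel_measurable (borel \<Otimes>\<^sub>M M)"
  proof (rule borel_measurable_LIMSEQ_real)
    fix p :: "real \<times> 'a" assume p: "p \<in> space (borel \<Otimes>\<^sub>M M)"
    define s where "s = max 0 (fst p)"
    have q_gt: "s < q n (fst p)" and q_le: "q n (fst p) \<le> s + 1 / real (Suc n)" for n
    proof -
      have "real (Suc n) * s < real_of_int \<lfloor>real (Suc n) * s\<rfloor> + 1"
        "real_of_int \<lfloor>real (Suc n) * s\<rfloor> \<le> real (Suc n) * s" by linarith+
      then show "s < q n (fst p)" "q n (fst p) \<le> s + 1 / real (Suc n)"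
        unfolding q_def s_def[symmetric] by (simp_all add: field_simps del: of_nat_Suc)
    qed
    have "(\<lambda>n. q n (fst p)) \<longlonglongrightarrow> s"
    proof (rule tendsto_sandwich[of "\<lambda>_. s" _ _ "\<lambda>n. s + 1 / real (Suc n)"])
      show "(\<lambda>n. s + 1 / real (Suc n)) \<longlonglongrightarrow> s"
        using tendsto_add[OF tendsto_const LIMSEQ_inverse_real_of_nat, of s] by (simp add: inverse_eq_divide)
    qed (use q_gt q_le in \<open>auto intro!: always_eventually simp: less_imp_le simp del: of_nat_Suc\<close>)
    then have "filterlim (\<lambda>n. q n (fst p)) (at_right s) sequentially"
      using q_gt by (simp add: filterlim_at less_imp_neq[THEN not_sym])
    moreover have "((\<lambda>s. X s (snd p)) \<longlongrightarrow> X s (snd p)) (at_right s)"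
      using rc[of "snd p" s] p by (auto simp: continuous_within s_def space_pair_measure)
    ultimately show "(\<lambda>n. X (q n (fst p)) (snd p)) \<longlonglongrightarrow> X (max 0 (fst p)) (snd p)"
      unfolding s_def[symmetric] by (rule filterlim_compose[rotated])
  next
    fix n
    let ?g = "\<lambda>p::real \<times> 'a. \<lfloor>real (Suc n) * max 0 (fst p)\<rfloor>"
    \<comment> \<open>The countable composition ranges over all integers k; \<open>max 0 k\<close>
      keeps the time nonnegative for each of them and changes nothing at the values that
      occur.\<close>
    have 1: "(\<lambda>p. X ((real_of_int (max 0 k) + 1) / real (Suc n)) (snd p)) \<in> borel_measurable (borel \<Otimes>\<^sub>M M)" for k :: int
      by (intro measurable_compose[OF measurable_snd X]) simp
    have 2: "?g \<in> measurable (borel \<Otimes>\<^sub>M M) (count_space UNIV)"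
      by measurable
    have "(\<lambda>p. X ((real_of_int (max 0 (?g p)) + 1) / real (Suc n)) (snd p)) \<in> borel_measurable (borel \<Otimes>\<^sub>M M)"
      by (rule measurable_compose_countable[OF 1 2])
    moreover have "max 0 \<lfloor>real (Suc n) * max 0 (s::real)\<rfloor> = \<lfloor>real (Suc n) * max 0 s\<rfloor>" for s
      by (simp add: max_def)
    ultimately show "(\<lambda>p. X (q n (fst p)) (snd p)) \<in> borel_measurable (borel \<Otimes>\<^sub>M M)"
      by (simp only: q_def)
  qed
  then show ?thesis by (simp add: split_beta')
qed

section \<open>Bounds for quotients of Gamma functions\<close>

lemma nn_integral_Beta:
  assumes "0 < a" "0 < (b::real)"
  shows "(\<integral>\<^sup>+t. ennreal (if 0 < t \<and> t < 1 then t powr (a - 1) * (1 - t) powr (b - 1) else 0) \<partial>lborel)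
    = ennreal (Beta a b)"
proof -
  have 1: "((\<lambda>t. t powr (a - 1) * (1 - t) powr (b - 1)) has_integral Beta a b) {0..1}"
    using assms by (rule has_integral_Beta_real)
  have "0 \<le> Beta a b"
    using assms by (simp add: Beta_def less_imp_le)
  with 1 have "(\<integral>\<^sup>+t. ennreal (indicator {0..1} t * (t powr (a - 1) * (1 - t) powr (b - 1))) \<partial>lborel) = ennreal (Beta a b)"
    using nn_integral_has_integral_lebesgue[OF _ 1] by simp
  then show ?thesis
    by (rule trans[rotated]) (intro nn_integral_cong, auto simp: indicator_def)
qed


text \<open>Cut the Beta integral off at x. There \<open>(1 - t) powr (b - 1)\<close> is at least
  \<open>(1 - t) powr b\<close>, hence at least \<open>(1 - x) powr b\<close>; passing to the
  exponent b gives a bound that is monotone in t for every positive b, including b < 1.\<close>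

lemma Beta_lower_bound:
  fixes s b x :: real
  assumes s: "0 < s" and b: "0 < b" and x: "0 < x" "x < 1"
  shows "(1 - x) powr b * (x powr s / s) \<le> Beta s b"
proof -
  let ?f = "\<lambda>t. t powr (s - 1) * (1 - t) powr (b - 1)"
  have B: "(?f has_integral Beta s b) {0..1}" using s b by (rule has_integral_Beta_real)
  then have "?f integrable_on {0..x}"
    using x by (intro integrable_subinterval_real[OF has_integral_integrable]) auto
  then have I: "(?f has_integral integral {0..x} ?f) {0..x}" by (rule integrable_integral)
  have "((\<lambda>t. (1 - x) powr b * t powr (s - 1)) has_integral (1 - x) powr b * (x powr (s - 1 + 1) / (s - 1 + 1))) {0..x}"
    using s x by (intro has_integral_mult_right has_integral_powr_from_0) auto
  then have "(1 - x) powr b * (x powr (s - 1 + 1) / (s - 1 + 1)) \<le> integral {0..x} ?f"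
  proof (rule has_integral_le[OF _ I])
    fix t assume t: "t \<in> {0..x}"
    have "(1 - x) powr b \<le> (1 - t) powr b" using t x b by (intro powr_mono2) auto
    also have "\<dots> \<le> (1 - t) powr (b - 1)" using t x by (intro powr_mono') auto
    finally show "(1 - x) powr b * t powr (s - 1) \<le> ?f t"
      by (subst mult.commute) (intro mult_left_mono; simp)
  qed
  also have "\<dots> \<le> Beta s b"
    using x by (intro has_integral_subset_le[OF _ I B]) auto
  finally show ?thesis by simp
qed

text \<open>The quotient \<open>Gamma r / Gamma (r - s)\<close> is
  \<open>Gamma s / Beta s (r - s)\<close>, so a lower bound for Beta bounds it from above. The
  right-hand side does not involve r, which makes the kernel integrable against any law of
  \<tau>.\<close>

lemma Gamma_quotient_bound:
  fixes s r x :: real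
  assumes "0 < s" "s < r" "0 < x" "x < 1"
  shows "(1 - x) powr r * Gamma r / Gamma (r - s) \<le> Gamma s * s * (1 - x) powr s / x powr s"
proof -
  have *: "A * g / h \<le> k * s * B / C" if "A / B * (C / s) \<le> k * h / g"
    "0 < B" "0 < C" "0 < g" "0 < h" for A B C g h k
    using that assms(1) by (simp add: field_simps)
  have "(1 - x) powr r / (1 - x) powr s * (x powr s / s) \<le> Gamma s * Gamma (r - s) / Gamma r"
    using Beta_lower_bound[of s "r - s" x] assms by (simp add: Beta_def powr_diff)
  then show ?thesis using assms by (intro *) auto
qed

text \<open>The singular factor 1 / (r - s) is absorbed by
  \<open>(r - s) * Gamma (r - s) = Gamma (r - s + 1)\<close>; the Beta function at
  \<open>r - s + 1\<close> stays under control as r decreases to s. Replacing a factor r by s then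
  makes the bound free of r.\<close>

lemma Gamma_quotient_bound_succ:
  fixes s r x :: real
  assumes "0 < s" "s < r" "0 < x" "x < 1"
  shows "1 / (r - s) * ((1 - x) powr r * Gamma r / Gamma (r - s)) \<le> Gamma s * (1 - x) powr (s - 1) / x powr s"
proof -
  have G: "0 < Gamma s" "0 < Gamma (r - s)" "0 < Gamma r" using assms by auto
  have G1: "Gamma (r - s + 1) = (r - s) * Gamma (r - s)" "Gamma (r + 1) = r * Gamma r"
    using assms by (auto intro!: Gamma_plus1 elim!: nonpos_Ints_cases)
  have "(1 - x) powr (r - (s - 1)) * (x powr s / s) \<le> Beta s (r - s + 1)"
    using Beta_lower_bound[of s "r - s + 1" x] assms by (simp add: algebra_simps)
  also have "\<dots> = Gamma s * ((r - s) * Gamma (r - s)) / (r * Gamma r)"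
    using G1 by (simp add: Beta_def)
  also have "\<dots> \<le> Gamma s * ((r - s) * Gamma (r - s)) / (s * Gamma r)"
    using assms G by (intro divide_left_mono mult_right_mono mult_nonneg_nonneg mult_pos_pos) auto
  finally have 1: "(1 - x) powr r / (1 - x) powr (s - 1) * (x powr s / s) \<le> Gamma s * ((r - s) * Gamma (r - s)) / (s * Gamma r)"
    using assms by (simp add: powr_diff[of _ r])
  have *: "1 / d * (A * g / h) \<le> k * B / C" if "A / B * (C / s) \<le> k * (d * h) / (s * g)"
    "0 < B" "0 < C" "0 < g" "0 < h" "0 < d" for A B C g h k d
    using that assms(1) by (simp add: field_simps)
  show ?thesis using assms by (intro *[OF 1]) auto
qed

section \<open>Scaling and normalising independent gamma variables\<close>

text \<open>Stated for every real \<open>a\<close>: \<open>product_sigma_finite\<close> asks for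
  sigma-finiteness at all indices, also at those outside the index set, where the parameter may be
  nonpositive.\<close>

lemma sigma_finite_gamma_dist: "sigma_finite_measure (gamma_dist a)"
  unfolding gamma_dist_def by (subst sigma_finite_measure.sigma_finite_iff_density_finite[OF sigma_finite_lborel]) auto

lemma nn_integral_gamma_dist:
  "f \<in> borel_measurable borel \<Longrightarrow>
    (\<integral>\<^sup>+x. f x \<partial>gamma_dist a) = (\<integral>\<^sup>+x. ennreal (gamma_density a x) * f x \<partial>lborel)"
  unfolding gamma_dist_def by (subst nn_integral_density) auto

definition gamma_prod :: "'i set \<Rightarrow> ('i \<Rightarrow> real) \<Rightarrow> ('i \<Rightarrow> real) measure" where
  "gamma_prod I a = PiM I (\<lambda>i. gamma_dist (a i))"

lemma sets_gamma_prod [measurable_cong, simp]: "sets (gamma_prod I a) = sets (PiM I (\<lambda>_. borel))"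
  unfolding gamma_prod_def by (rule sets_PiM_cong) auto

lemma nn_integral_gamma_prod_insert:
  assumes "finite I" "i \<notin> I" and [measurable]: "f \<in> borel_measurable (PiM (insert i I) (\<lambda>_. borel))"
  shows "(\<integral>\<^sup>+x. f x \<partial>gamma_prod (insert i I) a)
    = (\<integral>\<^sup>+x. (\<integral>\<^sup>+y. f (x(i := y)) \<partial>gamma_dist (a i)) \<partial>gamma_prod I a)"
proof -
  interpret product_sigma_finite "\<lambda>i. gamma_dist (a i)"
    by (simp add: product_sigma_finite_def sigma_finite_gamma_dist)
  have [measurable_cong]: "sets (PiM J (\<lambda>i. gamma_dist (a i))) = sets (PiM J (\<lambda>_. borel))" for J
    by (rule sets_PiM_cong) auto
  show ?thesis unfolding gamma_prod_def
    by (rule product_nn_integral_insert) (use assms in auto)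
qed

lemma prob_space_gamma_prod:
  assumes "\<And>i. i \<in> I \<Longrightarrow> 0 < a i"
  shows "prob_space (gamma_prod I a)"
  unfolding gamma_prod_def by (intro prob_space_PiM prob_space_gamma_dist assms)

lemma AE_gamma_prod_pos:
  assumes "finite I" "\<And>i. i \<in> I \<Longrightarrow> 0 < a i"
  shows "AE x in gamma_prod I a. \<forall>i\<in>I. 0 < x i"
proof -
  have "AE x in gamma_prod I a. 0 < x i" if "i \<in> I" for i
    unfolding gamma_prod_def using that assms
    by (intro AE_PiM_component[where P="\<lambda>y. 0 < y"] prob_space_gamma_dist AE_gamma_dist_pos)
  then show ?thesis using assms(1) by (intro AE_finite_allI)
qed

text \<open>The substitution of \<open>w * x\<close> for x. The resulting density ratio is an
  exponential tilt in x, and the shape \<open>a\<close> enters only as the exponent of w; under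
  products both therefore combine into sums.\<close>

lemma nn_integral_gamma_dist_scale:
  assumes a: "0 < a" and w: "0 < w" and [measurable]: "f \<in> borel_measurable borel"
  shows "(\<integral>\<^sup>+x. f (x / w) \<partial>gamma_dist a)
    = (\<integral>\<^sup>+x. f x * ennreal (exp ((1 - w) * x) * w powr a) \<partial>gamma_dist a)"
proof -
  have "(\<integral>\<^sup>+x. f (x / w) \<partial>gamma_dist a) = (\<integral>\<^sup>+x. ennreal (gamma_density a x) * f (x / w) \<partial>lborel)"
    by (rule nn_integral_gamma_dist) measurable
  also have "\<dots> = \<bar>w\<bar> * (\<integral>\<^sup>+x. ennreal (gamma_density a (0 + w * x)) * f ((0 + w * x) / w) \<partial>lborel)"
    using w by (intro nn_integral_real_affine) auto
  also have "\<dots> = (\<integral>\<^sup>+x. ennreal w * (ennreal (gamma_density a (w * x)) * f x) \<partial>lborel)"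
    using w by (subst nn_integral_cmult) auto
  also have "\<dots> = (\<integral>\<^sup>+x. ennreal (gamma_density a x) * (f x * ennreal (exp ((1 - w) * x) * w powr a)) \<partial>lborel)"
  proof (intro nn_integral_cong)
    fix x
    have "w * gamma_density a (w * x) = gamma_density a x * (exp ((1 - w) * x) * w powr a)"
      using w by (auto simp: gamma_density_def zero_less_mult_iff powr_mult powr_diff exp_minus
          algebra_simps exp_diff divide_simps)
    then have "ennreal w * ennreal (gamma_density a (w * x)) = ennreal (gamma_density a x) * ennreal (exp ((1 - w) * x) * w powr a)"
      using w a by (simp add: ennreal_mult[symmetric] gamma_density_nonneg)
    then show "ennreal w * (ennreal (gamma_density a (w * x)) * f x)
      = ennreal (gamma_density a x) * (f x * ennreal (exp ((1 - w) * x) * w powr a))"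
      by (metis (no_types, lifting) mult.assoc mult.commute)
  qed
  also have "\<dots> = (\<integral>\<^sup>+x. f x * ennreal (exp ((1 - w) * x) * w powr a) \<partial>gamma_dist a)"
    by (rule nn_integral_gamma_dist[symmetric]) measurable
  finally show ?thesis .
qed

text \<open>The coordinate densities multiply to a function of the total mass and the total shape
  alone. This is why the bridge density depends on the path up to u only through its value at
  u.\<close>

lemma nn_integral_gamma_prod_scale:
  assumes "finite I" "\<And>i. i \<in> I \<Longrightarrow> 0 < a i" and w: "0 < w"
    and "f \<in> borel_measurable (PiM I (\<lambda>_. borel))"
  shows "(\<integral>\<^sup>+x. f (\<lambda>i\<in>I. x i / w) \<partial>gamma_prod I a)
    = (\<integral>\<^sup>+x. f x * ennreal (exp ((1 - w) * (\<Sum>i\<in>I. x i)) * w powr (\<Sum>i\<in>I. a i)) \<partial>gamma_prod I a)"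
  using assms(1,2,4)
proof (induction I arbitrary: f)
  case empty
  have "restrict x {} = x" if "x \<in> space (gamma_prod {} a)" for x
    using that by (simp add: gamma_prod_def space_PiM)
  then show ?case using w by (intro nn_integral_cong) (auto simp: restrict_def)
next
  case (insert i I)
  note [measurable] = insert.prems(2)
  have ai: "0 < a i" using insert by auto
  interpret G: sigma_finite_measure "gamma_dist (a i)" by (rule sigma_finite_gamma_dist)
  let ?K = "\<lambda>x. \<integral>\<^sup>+y. f (x(i := y / w)) \<partial>gamma_dist (a i)"
  have upd: "(\<lambda>p. (fst p)(i := snd p)) \<in> measurable (PiM I (\<lambda>_. borel) \<Otimes>\<^sub>M borel) (PiM (insert i I) (\<lambda>_. borel))"
    using measurable_add_dim[of i I "\<lambda>_. borel"] by (simp add: split_beta')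
  have f1[measurable]: "(\<lambda>p. f ((fst p)(i := snd p))) \<in> borel_measurable (PiM I (\<lambda>_. borel) \<Otimes>\<^sub>M borel)"
    by (rule measurable_compose[OF upd insert.prems(2)])
  have f2: "(\<lambda>p. f ((fst p)(i := snd p / w))) \<in> borel_measurable (PiM I (\<lambda>_. borel) \<Otimes>\<^sub>M borel)"
    using measurable_compose[OF _ f1, of "\<lambda>p. (fst p, snd p / w)"] by simp
  have f3: "(\<lambda>y. f (x(i := y))) \<in> borel_measurable borel" if "x \<in> space (PiM I (\<lambda>_. borel))" for x
    using measurable_compose[OF _ f1, of "\<lambda>y. (x, y)" borel] that by simp
  have K: "?K \<in> borel_measurable (PiM I (\<lambda>_. borel))"
    by (rule G.borel_measurable_nn_integral) (use f2 in \<open>simp add: split_beta'\<close>)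
  have sp: "space (gamma_prod I a) = space (PiM I (\<lambda>_. borel))"
    by (rule sets_eq_imp_space_eq) simp
  have "(\<integral>\<^sup>+x. f (\<lambda>j\<in>insert i I. x j / w) \<partial>gamma_prod (insert i I) a)
      = (\<integral>\<^sup>+x. (\<integral>\<^sup>+y. f (\<lambda>j\<in>insert i I. (x(i := y)) j / w) \<partial>gamma_dist (a i)) \<partial>gamma_prod I a)"
    by (rule nn_integral_gamma_prod_insert) (use insert in auto)
  also have "\<dots> = (\<integral>\<^sup>+x. ?K (\<lambda>j\<in>I. x j / w) \<partial>gamma_prod I a)"
  proof (intro nn_integral_cong arg_cong[where f=f] ext)
    show "(\<lambda>j\<in>insert i I. (x(i := y)) j / w) j = ((\<lambda>j\<in>I. x j / w)(i := y / w)) j" for x y j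
      using insert(2) by (auto simp: restrict_def)
  qed
  also have "\<dots> = (\<integral>\<^sup>+x. ?K x * ennreal (exp ((1 - w) * (\<Sum>i\<in>I. x i)) * w powr (\<Sum>i\<in>I. a i)) \<partial>gamma_prod I a)"
    by (rule insert.IH[OF _ K]) (use insert.prems in auto)
  also have "\<dots> = (\<integral>\<^sup>+x. (\<integral>\<^sup>+y. f (x(i := y)) * ennreal (exp ((1 - w) * (\<Sum>j\<in>insert i I. (x(i:=y)) j)) * w powr (\<Sum>j\<in>insert i I. a j))
       \<partial>gamma_dist (a i)) \<partial>gamma_prod I a)"
  proof (intro nn_integral_cong)
    fix x assume "x \<in> space (gamma_prod I a)"
    then have [measurable]: "(\<lambda>y. f (x(i := y))) \<in> borel_measurable borel"
      by (intro f3) (simp add: sp)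
    let ?c = "exp ((1 - w) * (\<Sum>i\<in>I. x i)) * w powr (\<Sum>i\<in>I. a i)"
    have "?K x * ennreal ?c = (\<integral>\<^sup>+y. f (x(i := y)) * ennreal (exp ((1 - w) * y) * w powr a i) \<partial>gamma_dist (a i)) * ennreal ?c"
      by (subst nn_integral_gamma_dist_scale[OF ai w]) auto
    also have "\<dots> = (\<integral>\<^sup>+y. f (x(i := y)) * ennreal (exp ((1 - w) * y) * w powr a i) * ennreal ?c \<partial>gamma_dist (a i))"
      by (rule nn_integral_multc[symmetric]) measurable
    also have "\<dots> = (\<integral>\<^sup>+y. f (x(i := y)) * ennreal (exp ((1 - w) * (\<Sum>j\<in>insert i I. (x(i:=y)) j)) * w powr (\<Sum>j\<in>insert i I. a j)) \<partial>gamma_dist (a i))"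
    proof (intro nn_integral_cong)
      fix y
      have "(\<Sum>j\<in>I. (x(i:=y)) j) = (\<Sum>j\<in>I. x j)" using insert(2) by (intro sum.cong) auto
      then have "exp ((1 - w) * (\<Sum>j\<in>insert i I. (x(i:=y)) j)) * w powr (\<Sum>j\<in>insert i I. a j)
         = (exp ((1 - w) * y) * w powr a i) * ?c"
        using insert(1,2) by (simp add: powr_add distrib_left exp_add mult_ac)
      then show "f (x(i := y)) * ennreal (exp ((1 - w) * y) * w powr a i) * ennreal ?c =
        f (x(i := y)) * ennreal (exp ((1 - w) * (\<Sum>j\<in>insert i I. (x(i:=y)) j)) * w powr (\<Sum>j\<in>insert i I. a j))"
        by (simp add: ennreal_mult mult.assoc)
    qed
    finally show "?K x * ennreal ?c = \<dots>" .
  qed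
  also have "\<dots> = (\<integral>\<^sup>+x. f x * ennreal (exp ((1 - w) * (\<Sum>j\<in>insert i I. x j)) * w powr (\<Sum>j\<in>insert i I. a j)) \<partial>gamma_prod (insert i I) a)"
    by (rule nn_integral_gamma_prod_insert[symmetric]) (use insert in auto)
  finally show ?case .
qed

text \<open>The density at \<open>\<gamma>\<^sub>u = x\<close> of the gamma bridge of length \<open>r\<close> with respect to the gamma process
  itself, both observed up to time \<open>u\<close>.\<close>
definition bridge_weight :: "real \<Rightarrow> real \<Rightarrow> real \<Rightarrow> real" where
  "bridge_weight u r x =
    (if x < 1 then (1 - x) powr (r - u - 1) * exp x * Gamma r / Gamma (r - u) else 0)"

lemma borel_measurable_bridge_weight [measurable (raw)]:
  assumes [measurable]: "f \<in> borel_measurable N" "k \<in> borel_measurable N"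
  shows "(\<lambda>x. bridge_weight u (f x) (k x)) \<in> borel_measurable N"
  unfolding bridge_weight_def by measurable

lemma bridge_weight_nonneg: "0 \<le> u \<Longrightarrow> u < r \<Longrightarrow> 0 \<le> bridge_weight u r x"
  by (simp add: bridge_weight_def)

text \<open>The powers \<open>r - u - 1\<close> (from the remaining mass) and u (from the scaling)
  of w add up to \<open>r - 1\<close>, leaving a Gamma integral with parameter r. For
  \<open>x \<ge> 1\<close> the remaining mass \<open>w * (1 - x)\<close> is not positive and its
  density vanishes.\<close>

lemma bridge_weight_eq_nn_integral:
  assumes u: "0 \<le> u" and ur: "u < r"
  shows "(\<integral>\<^sup>+w. (if 0 < w then ennreal (gamma_density (r - u) (w * (1 - x)))
            * ennreal (exp ((1 - w) * x) * w powr u) else 0) \<partial>lborel)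
    = ennreal (bridge_weight u r x)"
proof (cases "x < 1")
  case True
  have "(\<integral>\<^sup>+w. (if 0 < w then ennreal (gamma_density (r - u) (w * (1 - x)))
            * ennreal (exp ((1 - w) * x) * w powr u) else 0) \<partial>lborel)
    = (\<integral>\<^sup>+w. ennreal ((1 - x) powr (r - u - 1) * exp x / Gamma (r - u))
         * ennreal (if 0 < w then w powr (r - 1) * exp (- 1 * w) else 0) \<partial>lborel)"
  proof (intro nn_integral_cong)
    fix w
    show "(if 0 < w then ennreal (gamma_density (r - u) (w * (1 - x))) * ennreal (exp ((1 - w) * x) * w powr u) else 0)
       = ennreal ((1 - x) powr (r - u - 1) * exp x / Gamma (r - u)) * ennreal (if 0 < w then w powr (r - 1) * exp (- 1 * w) else 0)"
    proof (cases "0 < w")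
      case w: True
      have e: "exp (- (w * (1 - x))) * exp ((1 - w) * x) = exp x * exp (- 1 * w)"
        unfolding exp_add[symmetric] by (simp add: algebra_simps)
      have p: "(w * (1 - x)) powr (r - u - 1) * w powr u = (1 - x) powr (r - u - 1) * w powr (r - 1)"
      proof -
        have "w powr (r - u - 1) * w powr u = w powr (r - 1)" unfolding powr_add[symmetric] by simp
        then show ?thesis using w True by (simp add: powr_mult)
      qed
      have "gamma_density (r - u) (w * (1 - x)) * (exp ((1 - w) * x) * w powr u)
          = ((w * (1 - x)) powr (r - u - 1) * w powr u) * (exp (- (w * (1 - x))) * exp ((1 - w) * x)) / Gamma (r - u)"
        using w True by (simp add: gamma_density_def)
      also have "\<dots> = (1 - x) powr (r - u - 1) * exp x / Gamma (r - u) * (w powr (r - 1) * exp (- 1 * w))"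
        unfolding e p by simp
      finally show ?thesis using w ur
        by (simp add: ennreal_mult[symmetric] gamma_density_nonneg)
    qed simp
  qed
  also have "\<dots> = ennreal ((1 - x) powr (r - u - 1) * exp x / Gamma (r - u)) * ennreal (Gamma r * 1 powr (- r))"
    using u ur by (subst nn_integral_cmult) (auto simp only: nn_integral_Gamma_scaled, auto)
  also have "\<dots> = ennreal (bridge_weight u r x)"
    using u ur True by (simp add: bridge_weight_def ennreal_mult[symmetric])
  finally show ?thesis .
next
  case False
  then have "\<not> 0 < w * (1 - x)" if "0 < w" for w
    using that by (simp add: zero_less_mult_iff)
  then have "(\<lambda>w. if 0 < w then ennreal (gamma_density (r - u) (w * (1 - x)))
            * ennreal (exp ((1 - w) * x) * w powr u) else 0) = (\<lambda>_. 0)"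
    by (auto simp: gamma_density_def fun_eq_iff)
  then show ?thesis using False by (simp add: bridge_weight_def)
qed

text \<open>Substitute \<open>w\<close> for the total mass \<open>\<Sum>x + y\<close>, undo the division by \<open>w\<close> with the scaling property,
  and integrate \<open>w\<close> out.\<close>
lemma nn_integral_gamma_prod_normalise:
  assumes I: "finite I" "\<And>i. i \<in> I \<Longrightarrow> 0 < a i" and u: "u = (\<Sum>i\<in>I. a i)" "u < r"
    and [measurable]: "f \<in> borel_measurable (PiM I (\<lambda>_. borel))"
  shows "(\<integral>\<^sup>+x. (\<integral>\<^sup>+y. f (\<lambda>i\<in>I. x i / ((\<Sum>i\<in>I. x i) + y)) \<partial>gamma_dist (r - u)) \<partial>gamma_prod I a)
    = (\<integral>\<^sup>+x. f x * ennreal (bridge_weight u r (\<Sum>i\<in>I. x i)) \<partial>gamma_prod I a)"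
proof -
  let ?S = "\<lambda>x. \<Sum>i\<in>I. x i"
  let ?g = "\<lambda>z. ennreal (gamma_density (r - u) z)"
  have u0: "0 \<le> u" using u I by (simp add: sum_nonneg less_imp_le)
  interpret P: prob_space "gamma_prod I a" by (rule prob_space_gamma_prod[OF I(2)])
  interpret PL: pair_sigma_finite "gamma_prod I a" lborel ..
  have pos: "AE x in gamma_prod I a. \<forall>i\<in>I. 0 < x i"
    using I by (rule AE_gamma_prod_pos)
  have "(\<integral>\<^sup>+x. (\<integral>\<^sup>+y. f (\<lambda>i\<in>I. x i / (?S x + y)) \<partial>gamma_dist (r - u)) \<partial>gamma_prod I a)
    = (\<integral>\<^sup>+x. (\<integral>\<^sup>+w. (if 0 < w then ?g (w - ?S x) * f (\<lambda>i\<in>I. x i / w) else 0) \<partial>lborel) \<partial>gamma_prod I a)"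
  proof (rule nn_integral_cong_AE)
    show "AE x in gamma_prod I a. (\<integral>\<^sup>+y. f (\<lambda>i\<in>I. x i / (?S x + y)) \<partial>gamma_dist (r - u))
      = (\<integral>\<^sup>+w. (if 0 < w then ?g (w - ?S x) * f (\<lambda>i\<in>I. x i / w) else 0) \<partial>lborel)"
      using pos
    proof eventually_elim
      case (elim x)
      then have S: "0 \<le> ?S x" by (simp add: sum_nonneg less_imp_le)
      have "(\<integral>\<^sup>+y. f (\<lambda>i\<in>I. x i / (?S x + y)) \<partial>gamma_dist (r - u))
        = (\<integral>\<^sup>+y. ?g y * f (\<lambda>i\<in>I. x i / (?S x + y)) \<partial>lborel)"
        by (rule nn_integral_gamma_dist) measurable
      also have "\<dots> = ennreal \<bar>1\<bar> * (\<integral>\<^sup>+w. ?g (- ?S x + 1 * w) * f (\<lambda>i\<in>I. x i / (?S x + (- ?S x + 1 * w))) \<partial>lborel)"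
        by (rule nn_integral_real_affine) auto
      \<comment> \<open>The guard \<open>0 < w\<close> costs nothing: the sum is nonnegative, so
        \<open>w - ?S x\<close> is not positive for \<open>w \<le> 0\<close> and the gamma density
        is 0 there. It is needed because scaling is available only for positive w.\<close>
      also have "\<dots> = (\<integral>\<^sup>+w. (if 0 < w then ?g (w - ?S x) * f (\<lambda>i\<in>I. x i / w) else 0) \<partial>lborel)"
      proof -
        have "?g (- ?S x + 1 * w) * f (\<lambda>i\<in>I. x i / (?S x + (- ?S x + 1 * w)))
           = (if 0 < w then ?g (w - ?S x) * f (\<lambda>i\<in>I. x i / w) else 0)" for w
          using S by (auto simp: gamma_density_def)
        then show ?thesis by simp
      qed
      finally show ?case .
    qed
  qed
  also have "\<dots> = (\<integral>\<^sup>+w. (\<integral>\<^sup>+x. (if 0 < w then ?g (w - ?S x) * f (\<lambda>i\<in>I. x i / w) else 0) \<partial>gamma_prod I a) \<partial>lborel)"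
    by (rule PL.Fubini'[symmetric]) measurable
  also have "\<dots> = (\<integral>\<^sup>+w. (\<integral>\<^sup>+x. (if 0 < w then ?g (w * (1 - ?S x)) * f x * ennreal (exp ((1 - w) * ?S x) * w powr u) else 0) \<partial>gamma_prod I a) \<partial>lborel)"
  proof (rule nn_integral_cong)
    fix w :: real
    show "(\<integral>\<^sup>+x. (if 0 < w then ?g (w - ?S x) * f (\<lambda>i\<in>I. x i / w) else 0) \<partial>gamma_prod I a)
      = (\<integral>\<^sup>+x. (if 0 < w then ?g (w * (1 - ?S x)) * f x * ennreal (exp ((1 - w) * ?S x) * w powr u) else 0) \<partial>gamma_prod I a)"
    proof (cases "0 < w")
      case True
      have "(\<integral>\<^sup>+x. ?g (w - ?S x) * f (\<lambda>i\<in>I. x i / w) \<partial>gamma_prod I a)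
        = (\<integral>\<^sup>+x. (\<lambda>z. ?g (w * (1 - ?S z)) * f z) (\<lambda>i\<in>I. x i / w) \<partial>gamma_prod I a)"
        using True by (intro nn_integral_cong)
          (simp add: sum_divide_distrib[symmetric] right_diff_distrib)
      also have "\<dots> = (\<integral>\<^sup>+x. ?g (w * (1 - ?S x)) * f x * ennreal (exp ((1 - w) * ?S x) * w powr u) \<partial>gamma_prod I a)"
        unfolding u(1) by (rule nn_integral_gamma_prod_scale) (use I True in auto)
      finally show ?thesis using True by simp
    qed simp
  qed
  also have "\<dots> = (\<integral>\<^sup>+x. (\<integral>\<^sup>+w. (if 0 < w then ?g (w * (1 - ?S x)) * f x * ennreal (exp ((1 - w) * ?S x) * w powr u) else 0) \<partial>lborel) \<partial>gamma_prod I a)"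
    by (rule PL.Fubini') measurable
  also have "\<dots> = (\<integral>\<^sup>+x. f x * ennreal (bridge_weight u r (?S x)) \<partial>gamma_prod I a)"
  proof (intro nn_integral_cong)
    fix x
    have "(\<integral>\<^sup>+w. (if 0 < w then ?g (w * (1 - ?S x)) * f x * ennreal (exp ((1 - w) * ?S x) * w powr u) else 0) \<partial>lborel)
      = (\<integral>\<^sup>+w. f x * (if 0 < w then ?g (w * (1 - ?S x)) * ennreal (exp ((1 - w) * ?S x) * w powr u) else 0) \<partial>lborel)"
      by (intro nn_integral_cong) (simp add: mult_ac)
    also have "\<dots> = f x * ennreal (bridge_weight u r (?S x))"
      by (subst nn_integral_cmult) (simp_all only: bridge_weight_eq_nn_integral[OF u0 u(2)], measurable)
    finally show "(\<integral>\<^sup>+w. (if 0 < w then ?g (w * (1 - ?S x)) * f x * ennreal (exp ((1 - w) * ?S x) * w powr u) else 0) \<partial>lborel)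
      = f x * ennreal (bridge_weight u r (?S x))" .
  qed
  finally show ?thesis .
qed

text \<open>The martingale property \<open>E [1 - \<zeta>\<^sub>u | \<zeta>\<^sub>s = x] = (1 - x) (r - u) / (r - s)\<close> of the gamma bridge of length
  \<open>r\<close>, expressed through bridge weights.\<close>
lemma nn_integral_bridge_weight_step:
  assumes "0 \<le> s" "s < u" "u < r"
  shows "(\<integral>\<^sup>+y. ennreal (1 - (x + y)) * ennreal (bridge_weight u r (x + y)) \<partial>gamma_dist (u - s))
    = ennreal ((r - u) / (r - s)) * (ennreal (1 - x) * ennreal (bridge_weight s r x))"
proof (cases "x < 1")
  case False
  have "AE y in gamma_dist (u - s). ennreal (1 - (x + y)) * ennreal (bridge_weight u r (x + y)) = 0"
    using AE_gamma_dist_pos by eventually_elim (use False in \<open>auto simp: ennreal_neg\<close>)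
  then have "(\<integral>\<^sup>+y. ennreal (1 - (x + y)) * ennreal (bridge_weight u r (x + y)) \<partial>gamma_dist (u - s)) = (\<integral>\<^sup>+y. 0 \<partial>gamma_dist (u - s))"
    by (rule nn_integral_cong_AE)
  then show ?thesis using False by (simp add: bridge_weight_def)
next
  case True
  define q where "q = 1 - x"
  have q: "0 < q" using True by (simp add: q_def)
  define C where "C = exp x * Gamma r / Gamma (r - u) / Gamma (u - s)"
  have C: "0 \<le> C" using assms unfolding C_def by (intro divide_nonneg_nonneg mult_nonneg_nonneg) auto
  have "(\<integral>\<^sup>+y. ennreal (1 - (x + y)) * ennreal (bridge_weight u r (x + y)) \<partial>gamma_dist (u - s))
     = (\<integral>\<^sup>+y. ennreal (gamma_density (u - s) y) * (ennreal (1 - (x + y)) * ennreal (bridge_weight u r (x + y))) \<partial>lborel)"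
    unfolding bridge_weight_def by (rule nn_integral_gamma_dist) measurable
  also have "\<dots> = (\<integral>\<^sup>+y. ennreal C * ennreal (if 0 < y \<and> y < q then y powr (u - s - 1) * (q - y) powr (r - u) else 0) \<partial>lborel)"
  proof (intro nn_integral_cong)
    fix y
    show "ennreal (gamma_density (u - s) y) * (ennreal (1 - (x + y)) * ennreal (bridge_weight u r (x + y)))
      = ennreal C * ennreal (if 0 < y \<and> y < q then y powr (u - s - 1) * (q - y) powr (r - u) else 0)"
    proof (cases "0 < y \<and> y < q")
      case y: True
      have qy: "1 - (x + y) = q - y" by (simp add: q_def)
      have lt: "x + y < 1" "0 < q - y" using y by (auto simp: q_def)
      \<comment> \<open>The factor \<open>1 - (x + y)\<close> raises the exponent by one. The second
        Beta parameter is therefore \<open>r - u + 1\<close> rather than \<open>r - u\<close>, and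
        this shift produces the linear factor of the claim.\<close>
      have p: "(q - y) powr (r - u) = (q - y) * (q - y) powr (r - u - 1)"
        using lt by (simp add: powr_diff)
      have e: "exp (x + y) * exp (- y) = exp x" unfolding exp_add[symmetric] by simp
      have "gamma_density (u - s) y * ((1 - (x + y)) * bridge_weight u r (x + y))
          = y powr (u - s - 1) * ((q - y) * (q - y) powr (r - u - 1)) * ((exp (x + y) * exp (- y)) * Gamma r / Gamma (r - u) / Gamma (u - s))"
        using y lt(1) unfolding gamma_density_def bridge_weight_def qy by (simp add: mult_ac)
      also have "\<dots> = C * (y powr (u - s - 1) * (q - y) powr (r - u))"
        unfolding e p C_def by simp
      finally show ?thesis using y lt C assms
        by (simp add: ennreal_mult[symmetric] gamma_density_nonneg bridge_weight_def)
    next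
      case False
      then have "gamma_density (u - s) y = 0 \<or> 1 - (x + y) \<le> 0" by (auto simp: gamma_density_def q_def)
      then show ?thesis using False by (auto simp: ennreal_neg)
    qed
  qed
  also have "\<dots> = ennreal C * (\<integral>\<^sup>+y. ennreal (if 0 < y \<and> y < q then y powr (u - s - 1) * (q - y) powr (r - u) else 0) \<partial>lborel)"
    by (rule nn_integral_cmult) measurable
  also have "(\<integral>\<^sup>+y. ennreal (if 0 < y \<and> y < q then y powr (u - s - 1) * (q - y) powr (r - u) else 0) \<partial>lborel)
     = \<bar>q\<bar> * (\<integral>\<^sup>+t. ennreal (if 0 < 0 + q * t \<and> 0 + q * t < q then (0 + q * t) powr (u - s - 1) * (q - (0 + q * t)) powr (r - u) else 0) \<partial>lborel)"
    using q by (intro nn_integral_real_affine) auto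
  also have "(\<integral>\<^sup>+t. ennreal (if 0 < 0 + q * t \<and> 0 + q * t < q then (0 + q * t) powr (u - s - 1) * (q - (0 + q * t)) powr (r - u) else 0) \<partial>lborel)
     = (\<integral>\<^sup>+t. ennreal (q powr (r - s - 1)) * ennreal (if 0 < t \<and> t < 1 then t powr (u - s - 1) * (1 - t) powr (r - u + 1 - 1) else 0) \<partial>lborel)"
  proof (intro nn_integral_cong)
    fix t
    have c: "0 < 0 + q * t \<and> 0 + q * t < q \<longleftrightarrow> 0 < t \<and> t < 1"
      using q by (simp add: zero_less_mult_iff)
    have d: "q - (0 + q * t) = q * (1 - t)" by (simp add: algebra_simps)
    have e: "q powr (u - s - 1) * q powr (r - u) = q powr (r - s - 1)"
      unfolding powr_add[symmetric] by (simp add: algebra_simps)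
    show "ennreal (if 0 < 0 + q * t \<and> 0 + q * t < q then (0 + q * t) powr (u - s - 1) * (q - (0 + q * t)) powr (r - u) else 0)
      = ennreal (q powr (r - s - 1)) * ennreal (if 0 < t \<and> t < 1 then t powr (u - s - 1) * (1 - t) powr (r - u + 1 - 1) else 0)"
      unfolding c d e[symmetric] using q by (simp add: powr_mult ennreal_mult[symmetric] mult_ac)
  qed
  also have "\<dots> = ennreal (q powr (r - s - 1)) * ennreal (Beta (u - s) (r - u + 1))"
    using assms by (subst nn_integral_cmult) (simp_all only: nn_integral_Beta, auto)
  also have "ennreal C * (\<bar>q\<bar> * (ennreal (q powr (r - s - 1)) * ennreal (Beta (u - s) (r - u + 1))))
     = ennreal (C * (q * (q powr (r - s - 1) * Beta (u - s) (r - u + 1))))"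
  proof -
    have "0 \<le> Beta (u - s) (r - u + 1)"
      using assms unfolding Beta_def by (intro divide_nonneg_nonneg mult_nonneg_nonneg) auto
    then show ?thesis using q C by (simp add: ennreal_mult)
  qed
  \<comment> \<open>The recursion of Gamma at \<open>r - u + 1\<close> and at
    \<open>r - s + 1\<close> contributes the numerator and the denominator of
    \<open>(r - u) / (r - s)\<close>; the remaining Gamma values reassemble to the weight at time
    s.\<close>
  also have "C * (q * (q powr (r - s - 1) * Beta (u - s) (r - u + 1))) = (r - u) / (r - s) * (q * bridge_weight s r x)"
  proof -
    have G: "Gamma (r - s) \<noteq> 0" "Gamma (r - u) \<noteq> 0" "Gamma (u - s) \<noteq> 0"
      using assms Gamma_real_pos[of "r - s"] Gamma_real_pos[of "r - u"] Gamma_real_pos[of "u - s"] by linarith+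
    have G1: "Gamma (r - u + 1) = (r - u) * Gamma (r - u)" "Gamma (r - s + 1) = (r - s) * Gamma (r - s)"
      using assms by (auto intro!: Gamma_plus1 elim!: nonpos_Ints_cases)
    have "u - s + (r - u + 1) = r - s + 1" by simp
    then have "Beta (u - s) (r - u + 1) = Gamma (u - s) * ((r - u) * Gamma (r - u)) / ((r - s) * Gamma (r - s))"
      by (simp only: Beta_def G1)
    then show ?thesis using G assms True
      unfolding C_def bridge_weight_def q_def by (simp add: divide_simps)
  qed
  also have "ennreal ((r - u) / (r - s) * (q * bridge_weight s r x))
      = ennreal ((r - u) / (r - s)) * (ennreal (1 - x) * ennreal (bridge_weight s r x))"
    using q assms by (simp add: ennreal_mult[symmetric] q_def[symmetric] bridge_weight_nonneg)
  finally show ?thesis .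
qed

section \<open>The drift coefficient\<close>

text \<open>The drift depends on \<omega> only through the current value of the process. Isolating
  the state as a real argument permits evaluation under the finite-dimensional laws and composition
  with measurable processes.\<close>

definition drift_coeff :: "real measure \<Rightarrow> real \<Rightarrow> real \<Rightarrow> real" where
  "drift_coeff P s x = (1 - x) * (\<integral>r\<in>{s<..}. inner_integrand P s x r \<partial>P) * indicator {x. 0 < x \<and> x < 1} x"

lemma drift_eq_drift_coeff: "drift P X s \<omega> = drift_coeff P s (X s \<omega>)"
  by (simp add: drift_def drift_coeff_def)

locale real_law = prob_space P for P :: "real measure" +
  assumes sets_P [measurable_cong, simp]: "sets P = sets borel"
begin

text \<open>Up to a factor free of r, the likelihood of the bridge length r when the value x is
  observed at time s; \<open>phi\<close> is its normalisation against the law of \<tau>.\<close>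

abbreviation bayes_kernel :: "real \<Rightarrow> real \<Rightarrow> real \<Rightarrow> real" where
  "bayes_kernel s x r \<equiv> (1 - x) powr r * Gamma r / Gamma (r - s)"

lemma space_P [simp]: "space P = UNIV"
  using sets_eq_imp_space_eq[OF sets_P] by simp

lemma set_integrable_bayes_kernel:
  assumes "0 < s" "0 < x" "x < 1"
  shows "set_integrable P {s<..} (bayes_kernel s x)"
    and "set_integrable P {s<..} (\<lambda>r. 1 / (r - s) * bayes_kernel s x r)"
proof -
  have pos: "0 \<le> bayes_kernel s x r" "0 \<le> 1 / (r - s)" if "s < r" for r
    using assms that by auto
  show "set_integrable P {s<..} (bayes_kernel s x)"
    unfolding set_integrable_def
    by (rule integrable_const_bound[where B="Gamma s * s * (1 - x) powr s / x powr s"])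
      (use pos(1) assms Gamma_quotient_bound[of s _ x] in \<open>auto simp: indicator_def intro!: AE_I2\<close>)
  have "0 \<le> Gamma s * (1 - x) powr (s - 1) / x powr s" using assms by auto
  moreover have "\<bar>1 / (r - s) * bayes_kernel s x r\<bar> \<le> Gamma s * (1 - x) powr (s - 1) / x powr s" if "s < r" for r
    using Gamma_quotient_bound_succ[OF assms(1) that assms(2,3)] mult_nonneg_nonneg[OF pos(2,1)[OF that]] by linarith
  ultimately show "set_integrable P {s<..} (\<lambda>r. 1 / (r - s) * bayes_kernel s x r)"
    unfolding set_integrable_def
    by (intro integrable_const_bound[where B="Gamma s * (1 - x) powr (s - 1) / x powr s"])
      (auto simp: indicator_def intro!: AE_I2 simp del: times_divide_eq_left times_divide_eq_right)
qed

lemma inner_integrand_eq: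
  assumes "0 < x" "x < 1"
  shows "inner_integrand P s x r = 1 / (r - s) * bayes_kernel s x r / (\<integral>v\<in>{s<..}. bayes_kernel s x v \<partial>P)"
  using assms by (simp add: inner_integrand_def phi_def)

lemma set_integrable_inner_integrand:
  assumes "0 < s" "0 < x" "x < 1"
  shows "set_integrable P {s<..} (inner_integrand P s x)"
  unfolding inner_integrand_eq[OF assms(2,3)]
  by (intro set_integrable_divide set_integrable_bayes_kernel assms)

lemma drift_coeff_nonneg:
  assumes "0 \<le> s"
  shows "0 \<le> drift_coeff P s x"
proof (cases "0 < x \<and> x < 1")
  case True
  have "0 \<le> (\<integral>v\<in>{s<..}. bayes_kernel s x v \<partial>P)"
    unfolding set_lebesgue_integral_def
    using assms True by (intro integral_nonneg_AE AE_I2) (auto simp: indicator_def)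
  then have "0 \<le> (\<integral>r\<in>{s<..}. inner_integrand P s x r \<partial>P)"
    unfolding set_lebesgue_integral_def[of _ _ "inner_integrand P s x"]
    using assms True by (intro integral_nonneg_AE AE_I2) (auto simp: indicator_def inner_integrand_eq)
  then show ?thesis using True by (simp add: drift_coeff_def)
qed (simp add: drift_coeff_def)

text \<open>The parameter s also occurs in the domain \<open>{s<..}\<close> of the integrals. Moving
  it into the integrand as a conditional leaves integrals over a fixed space of jointly measurable
  functions.\<close>

lemma borel_measurable_drift_coeff [measurable]:
  "(\<lambda>p. drift_coeff P (fst p) (snd p)) \<in> borel_measurable (borel \<Otimes>\<^sub>M borel)"
proof -
  have D[measurable]: "(\<lambda>p. \<integral>v. (if fst p < v then bayes_kernel (fst p) (snd p) v else 0) \<partial>P) \<in> borel_measurable (borel \<Otimes>\<^sub>M borel)"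
    by (rule borel_measurable_lebesgue_integral) measurable
  have J[measurable]: "(\<lambda>p. \<integral>r. (if fst p < r then 1 / (r - fst p) * bayes_kernel (fst p) (snd p) r
        / (\<integral>v. (if fst p < v then bayes_kernel (fst p) (snd p) v else 0) \<partial>P) else 0) \<partial>P) \<in> borel_measurable (borel \<Otimes>\<^sub>M borel)"
    by (rule borel_measurable_lebesgue_integral) measurable
  have i: "indicator {s<..} r *\<^sub>R (y :: real) = (if s < r then y else 0)" for s r y :: real
    by simp
  have "(\<lambda>p. drift_coeff P (fst p) (snd p)) = (\<lambda>p. if 0 < snd p \<and> snd p < 1 then (1 - snd p) *
      (\<integral>r. (if fst p < r then 1 / (r - fst p) * bayes_kernel (fst p) (snd p) r
        / (\<integral>v. (if fst p < v then bayes_kernel (fst p) (snd p) v else 0) \<partial>P) else 0) \<partial>P) else 0)"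
  proof (intro ext)
    fix p :: "real \<times> real"
    show "drift_coeff P (fst p) (snd p) = (if 0 < snd p \<and> snd p < 1 then (1 - snd p) *
      (\<integral>r. (if fst p < r then 1 / (r - fst p) * bayes_kernel (fst p) (snd p) r
        / (\<integral>v. (if fst p < v then bayes_kernel (fst p) (snd p) v else 0) \<partial>P) else 0) \<partial>P) else 0)"
    proof (cases "0 < snd p \<and> snd p < 1")
      case True
      then show ?thesis
        unfolding drift_coeff_def inner_integrand_eq[OF True[THEN conjunct1] True[THEN conjunct2]]
          set_lebesgue_integral_def i by simp
    qed (auto simp: drift_coeff_def)
  qed
  also have "\<dots> \<in> borel_measurable (borel \<Otimes>\<^sub>M borel)"
    by measurable
  finally show ?thesis .
qed

lemma bridge_weight_eq_bayes_kernel: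
  assumes "x < 1"
  shows "bridge_weight u r x = (1 - x) powr (- u - 1) * exp x * bayes_kernel u x r"
proof -
  have "(1 - x) powr (r - u - 1) = (1 - x) powr (- u - 1) * (1 - x) powr r"
    unfolding powr_add[symmetric] by (simp add: algebra_simps)
  then show ?thesis using assms by (simp add: bridge_weight_def)
qed

text \<open>Bayes' rule: the drift is the average of \<open>(1 - x) / (r - u)\<close> over the conditional law of \<open>\<tau>\<close>.\<close>
lemma drift_coeff_bayes:
  assumes u: "0 < u" and x: "0 < x" "x < 1"
  shows "(\<integral>\<^sup>+r. (if u < r then ennreal (drift_coeff P u x) * ennreal (bridge_weight u r x) else 0) \<partial>P)
    = (\<integral>\<^sup>+r. (if u < r then ennreal (1 - x) * ennreal (1 / (r - u)) * ennreal (bridge_weight u r x) else 0) \<partial>P)"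
proof -
  define D where "D = (\<integral>v\<in>{u<..}. bayes_kernel u x v \<partial>P)"
  define J where "J = (\<integral>r\<in>{u<..}. 1 / (r - u) * bayes_kernel u x r \<partial>P)"
  define c where "c = (1 - x) powr (- u - 1) * exp x"
  have c0: "0 \<le> c" by (simp add: c_def)
  have pos: "0 < bayes_kernel u x r" if "u < r" for r
    using u x that by auto
  have D0: "0 \<le> D" unfolding D_def set_lebesgue_integral_def
    using u x by (intro integral_nonneg_AE AE_I2) (auto simp: indicator_def)
  have J0: "0 \<le> J" unfolding J_def set_lebesgue_integral_def
    using u x by (intro integral_nonneg_AE AE_I2) (auto simp: indicator_def)
  have Dn: "(\<integral>\<^sup>+r. (if u < r then ennreal (bayes_kernel u x r) else 0) \<partial>P) = ennreal D"
    unfolding D_def set_lebesgue_integral_def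
    using set_integrable_bayes_kernel(1)[OF u x] u x
    by (subst nn_integral_eq_integral[symmetric])
      (auto simp: set_integrable_def indicator_def intro!: nn_integral_cong)
  have Jn: "(\<integral>\<^sup>+r. (if u < r then ennreal (1 / (r - u) * bayes_kernel u x r) else 0) \<partial>P) = ennreal J"
    unfolding J_def set_lebesgue_integral_def
    using set_integrable_bayes_kernel(2)[OF u x] u x
    by (subst nn_integral_eq_integral[symmetric])
      (auto simp: set_integrable_def indicator_def intro!: nn_integral_cong)
  have "(\<integral>r\<in>{u<..}. 1 / (r - u) * bayes_kernel u x r / D \<partial>P) = J / D"
    unfolding J_def by (rule set_integral_divide_zero)
  then have dc: "drift_coeff P u x = (1 - x) * (J / D)"
    using x unfolding drift_coeff_def inner_integrand_eq[OF x] D_def[symmetric] by simp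
  \<comment> \<open>If the normalising constant is 0, division returns 0, and the claim reduces to J
    = 0. This holds because the kernel is strictly positive beyond u, so D = 0 means that the law
    has no mass there.\<close>
  have DJ: "J / D * D = J"
  proof (cases "D = 0")
    case True
    then have "AE r in P. (if u < r then ennreal (bayes_kernel u x r) else 0) = 0"
      using Dn by (subst nn_integral_0_iff_AE[symmetric]) auto
    then have "AE r in P. \<not> u < r"
    proof eventually_elim
      case (elim r)
      then show ?case using pos[of r] by (auto split: if_splits simp: ennreal_eq_0_iff)
    qed
    then have "AE r in P. indicator {u<..} r *\<^sub>R (1 / (r - u) * bayes_kernel u x r) = 0"
      by eventually_elim simp
    then have "J = 0" unfolding J_def set_lebesgue_integral_def
      by (rule integral_eq_zero_AE)
    then show ?thesis by simp
  qed simp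
  have "(\<integral>\<^sup>+r. (if u < r then ennreal (drift_coeff P u x) * ennreal (bridge_weight u r x) else 0) \<partial>P)
     = (\<integral>\<^sup>+r. ennreal ((1 - x) * (J / D) * c) * (if u < r then ennreal (bayes_kernel u x r) else 0) \<partial>P)"
    unfolding dc bridge_weight_eq_bayes_kernel[OF x(2)] c_def[symmetric]
  proof (intro nn_integral_cong)
    fix r
    show "(if u < r then ennreal ((1 - x) * (J / D)) * ennreal (c * bayes_kernel u x r) else 0)
      = ennreal ((1 - x) * (J / D) * c) * (if u < r then ennreal (bayes_kernel u x r) else 0)"
    proof (cases "u < r")
      case True
      have "0 \<le> (1 - x) * (J / D)" using x J0 D0 by simp
      then show ?thesis using True c0 less_imp_le[OF pos[OF True]]
        by (simp only: ennreal_mult mult.assoc[where 'a=ennreal] if_True)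
    qed simp
  qed
  also have "\<dots> = ennreal ((1 - x) * (J / D) * c) * ennreal D"
    unfolding Dn[symmetric] by (rule nn_integral_cmult) measurable
  also have "\<dots> = ennreal ((1 - x) * c * J)"
    using x J0 D0 c0 DJ by (simp add: ennreal_mult[symmetric] mult_ac del: times_divide_eq_left times_divide_eq_right)
  also have "\<dots> = ennreal ((1 - x) * c) * ennreal J"
    using x J0 c0 by (simp add: ennreal_mult)
  also have "\<dots> = (\<integral>\<^sup>+r. ennreal ((1 - x) * c) * (if u < r then ennreal (1 / (r - u) * bayes_kernel u x r) else 0) \<partial>P)"
    unfolding Jn[symmetric] by (rule nn_integral_cmult[symmetric]) measurable
  also have "\<dots> = (\<integral>\<^sup>+r. (if u < r then ennreal (1 - x) * ennreal (1 / (r - u)) * ennreal (bridge_weight u r x) else 0) \<partial>P)"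
    unfolding bridge_weight_eq_bayes_kernel[OF x(2)] c_def[symmetric]
  proof (intro nn_integral_cong)
    fix r
    show "ennreal ((1 - x) * c) * (if u < r then ennreal (1 / (r - u) * bayes_kernel u x r) else 0)
      = (if u < r then ennreal (1 - x) * ennreal (1 / (r - u)) * ennreal (c * bayes_kernel u x r) else 0)"
    proof (cases "u < r")
      case True
      have r: "0 \<le> 1 / (r - u)" using True by simp
      have "0 \<le> 1 / (r - u) * bayes_kernel u x r" "0 \<le> c * bayes_kernel u x r"
        by (rule mult_nonneg_nonneg[OF _ less_imp_le[OF pos[OF True]]], fact)+
      moreover have "(1 - x) * c * (1 / (r - u) * bayes_kernel u x r) = (1 - x) * (1 / (r - u)) * (c * bayes_kernel u x r)"
        by simp
      ultimately show ?thesis using True x c0 r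
        by (simp add: ennreal_mult[symmetric] del: times_divide_eq_left times_divide_eq_right)
    qed simp
  qed
  finally show ?thesis .
qed

end

section \<open>The gamma process and an independent random time\<close>

locale gamma_bridge = prob_space M for M :: "'a measure" +
  fixes g :: "real \<Rightarrow> 'a \<Rightarrow> real" and \<tau> :: "'a \<Rightarrow> real"
  assumes gamma: "standard_gamma_process M g"
    and tau [measurable]: "\<tau> \<in> borel_measurable M"
    and tau_pos: "\<And>\<omega>. \<omega> \<in> space M \<Longrightarrow> 0 < \<tau> \<omega>"
    and indep: "indep_set
           (sigma_sets (space M) {\<tau> -` B \<inter> space M | B. B \<in> sets borel})
           (sigma_sets (space M) (\<Union>t\<in>{0..}. {g t -` B \<inter> space M | B. B \<in> sets borel}))"
begin

abbreviation Z :: "real \<Rightarrow> 'a \<Rightarrow> real" where "Z \<equiv> zeta g \<tau>"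

abbreviation law :: "real measure" where "law \<equiv> distr M borel \<tau>"

sublocale law: real_law law
  by (simp add: real_law_def real_law_axioms_def prob_space_distr)

lemma g_measurable [measurable]: "0 \<le> t \<Longrightarrow> g t \<in> borel_measurable M"
  and g_0: "\<omega> \<in> space M \<Longrightarrow> g 0 \<omega> = 0"
  and g_right_continuous: "\<omega> \<in> space M \<Longrightarrow> 0 \<le> t \<Longrightarrow> continuous (at_right t) (\<lambda>s. g s \<omega>)"
  and g_indep: "0 \<le> ts 0 \<Longrightarrow> (\<And>i. i < n \<Longrightarrow> ts i < ts (Suc i)) \<Longrightarrow>
      indep_vars (\<lambda>_. borel) (\<lambda>i \<omega>. g (ts (Suc i)) \<omega> - g (ts i) \<omega>) {..<n}"
  and g_Laplace: "0 \<le> s \<Longrightarrow> s \<le> t \<Longrightarrow> 0 \<le> l \<Longrightarrow>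
      (\<integral>\<omega>. exp (- l * (g t \<omega> - g s \<omega>)) \<partial>M) = (1 + l) powr (- (t - s))"
  using gamma unfolding standard_gamma_process_def by blast+

lemma distr_increment:
  assumes "0 \<le> s" "s < t"
  shows "distr M borel (\<lambda>\<omega>. g t \<omega> - g s \<omega>) = gamma_dist (t - s)"
  using assms g_Laplace[of s t] by (intro distr_eq_gamma_dist_if_Laplace) auto

lemma AE_increment_pos:
  assumes "0 \<le> s" "s < t"
  shows "AE \<omega> in M. g s \<omega> < g t \<omega>"
proof -
  have "AE x in distr M borel (\<lambda>\<omega>. g t \<omega> - g s \<omega>). 0 < x"
    unfolding distr_increment[OF assms] by (rule AE_gamma_dist_pos)
  then show ?thesis using assms by (subst (asm) AE_distr_iff) auto
qed

text \<open>The sigma-algebra of \<gamma> alone. The point \<omega>, read in \<open>G\<close>,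
  stands for the whole path of \<gamma>, so that independence becomes a product law for the pair of
  \<tau> and \<omega> without a path space.\<close>

definition G :: "'a measure" where
  "G = sigma (space M) (\<Union>t\<in>{0..}. {g t -` B \<inter> space M | B. B \<in> sets borel})"

lemma space_G [simp]: "space G = space M"
  unfolding G_def by (rule space_measure_of) auto

lemma sets_G: "sets G = sigma_sets (space M) (\<Union>t\<in>{0..}. {g t -` B \<inter> space M | B. B \<in> sets borel})"
  unfolding G_def by (intro sets_measure_of) auto

lemma subalgebra_G: "subalgebra M G"
  using indep unfolding subalgebra_def sets_G indep_sets2_eq by simp

lemma g_measurable_G [measurable]: "0 \<le> t \<Longrightarrow> g t \<in> borel_measurable G"
  by (rule measurableI) (auto simp: sets_G intro!: sigma_sets.Basic)

lemma g_jointly_measurable [measurable]: "(\<lambda>p. g (max 0 (fst p)) (snd p)) \<in> borel_measurable (borel \<Otimes>\<^sub>M G)"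
  using right_continuous_jointly_measurable[of g G] by (simp add: g_right_continuous split_beta')

lemma measurable_ident_G [measurable]: "(\<lambda>\<omega>. \<omega>) \<in> measurable M G"
  by (rule measurable_from_subalg[OF subalgebra_G measurable_ident_sets[OF refl]])

section \<open>Freezing the independent random time\<close>

lemma distr_tau_G: "distr M (borel \<Otimes>\<^sub>M G) (\<lambda>\<omega>. (\<tau> \<omega>, \<omega>)) = law \<Otimes>\<^sub>M distr M G (\<lambda>\<omega>. \<omega>)"
proof (rule pair_measure_eqI[symmetric])
  interpret GM: prob_space "distr M G (\<lambda>\<omega>. \<omega>)" by (rule prob_space_distr) measurable
  show "sigma_finite_measure (distr M G (\<lambda>\<omega>. \<omega>))" ..
  show "sigma_finite_measure law" ..
  fix A B assume "A \<in> sets law" "B \<in> sets (distr M G (\<lambda>\<omega>. \<omega>))"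
  then have [measurable]: "A \<in> sets borel" "B \<in> sets G" by auto
  have BM[measurable]: "B \<in> sets M" using \<open>B \<in> sets G\<close> subalgebra_G by (auto simp: subalgebra_def)
  have sub: "B \<subseteq> space M" using sets.sets_into_space[OF BM] .
  have "prob ((\<tau> -` A \<inter> space M) \<inter> B) = prob (\<tau> -` A \<inter> space M) * prob B"
  proof -
    have "\<tau> -` A \<inter> space M \<in> sigma_sets (space M) {\<tau> -` B \<inter> space M | B. B \<in> sets borel}"
      by (intro sigma_sets.Basic) auto
    moreover have "B \<in> sigma_sets (space M) (\<Union>t\<in>{0..}. {g t -` B \<inter> space M | B. B \<in> sets borel})"
      using \<open>B \<in> sets G\<close> by (simp add: sets_G)
    ultimately show ?thesis using indep unfolding indep_sets2_eq by blast
  qed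
  moreover have "(\<lambda>\<omega>. (\<tau> \<omega>, \<omega>)) -` (A \<times> B) \<inter> space M = (\<tau> -` A \<inter> space M) \<inter> B"
    "(\<lambda>\<omega>. \<omega>) -` B \<inter> space M = B" using sub by auto
  ultimately show "emeasure law A * emeasure (distr M G (\<lambda>\<omega>. \<omega>)) B
      = emeasure (distr M (borel \<Otimes>\<^sub>M G) (\<lambda>\<omega>. (\<tau> \<omega>, \<omega>))) (A \<times> B)"
    by (simp add: emeasure_distr emeasure_eq_measure ennreal_mult)
qed (auto intro!: sets_pair_measure_cong)

text \<open>Conditioning on \<tau> = r in the form of Tonelli's theorem. Measurability with respect
  to \<open>G\<close> in the second argument ensures that f sees \<omega> only through \<gamma>,
  hence that \<tau> can be frozen.\<close>

lemma nn_integral_tau_G: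
  assumes [measurable]: "f \<in> borel_measurable (borel \<Otimes>\<^sub>M G)"
  shows "(\<integral>\<^sup>+\<omega>. f (\<tau> \<omega>, \<omega>) \<partial>M) = (\<integral>\<^sup>+r. (\<integral>\<^sup>+\<omega>. f (r, \<omega>) \<partial>M) \<partial>law)"
proof -
  interpret GM: prob_space "distr M G (\<lambda>\<omega>. \<omega>)" by (rule prob_space_distr) measurable
  have "(\<integral>\<^sup>+\<omega>. f (\<tau> \<omega>, \<omega>) \<partial>M) = (\<integral>\<^sup>+p. f p \<partial>distr M (borel \<Otimes>\<^sub>M G) (\<lambda>\<omega>. (\<tau> \<omega>, \<omega>)))"
    by (rule nn_integral_distr[symmetric]) measurable
  also note distr_tau_G
  also have "(\<integral>\<^sup>+p. f p \<partial>(law \<Otimes>\<^sub>M distr M G (\<lambda>\<omega>. \<omega>))) = (\<integral>\<^sup>+r. (\<integral>\<^sup>+\<omega>. f (r, \<omega>) \<partial>distr M G (\<lambda>\<omega>. \<omega>)) \<partial>law)"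
    by (rule GM.nn_integral_fst[symmetric]) measurable
  also have "\<dots> = (\<integral>\<^sup>+r. (\<integral>\<^sup>+\<omega>. f (r, \<omega>) \<partial>M) \<partial>law)"
    using measurable_compose[OF measurable_Pair1' assms]
    by (intro nn_integral_cong_simp) (simp add: nn_integral_distr[OF measurable_ident_G])
  finally show ?thesis .
qed

text \<open>The exceptional set may depend on r; Tonelli's theorem still makes the set of failures
  at \<tau> null, which no union over r could do.\<close>

lemma AE_tau_G:
  fixes P :: "real \<times> 'a \<Rightarrow> bool"
  assumes [measurable]: "Measurable.pred (borel \<Otimes>\<^sub>M G) P"
    and "\<And>r. 0 < r \<Longrightarrow> AE \<omega> in M. P (r, \<omega>)"
  shows "AE \<omega> in M. P (\<tau> \<omega>, \<omega>)"
proof -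
  let ?f = "\<lambda>p. if P p then 0 else 1 :: ennreal"
  have "(\<integral>\<^sup>+\<omega>. ?f (\<tau> \<omega>, \<omega>) \<partial>M) = (\<integral>\<^sup>+r. (\<integral>\<^sup>+\<omega>. ?f (r, \<omega>) \<partial>M) \<partial>law)"
    by (rule nn_integral_tau_G) measurable
  also have "\<dots> = (\<integral>\<^sup>+r. 0 \<partial>law)"
  proof (rule nn_integral_cong_AE)
    have "AE r in law. 0 < r" using tau_pos by (subst AE_distr_iff) auto
    then show "AE r in law. (\<integral>\<^sup>+\<omega>. ?f (r, \<omega>) \<partial>M) = 0"
    proof eventually_elim
      case (elim r)
      have "AE \<omega> in M. ?f (r, \<omega>) = 0" using assms(2)[OF elim] by eventually_elim simp
      then show ?case by (subst nn_integral_0_iff_AE) auto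
    qed
  qed
  finally have "AE \<omega> in M. ?f (\<tau> \<omega>, \<omega>) = 0"
    by (subst nn_integral_0_iff_AE[symmetric]) auto
  then show ?thesis by eventually_elim (auto split: if_splits)
qed

section \<open>Path properties of the normalised process\<close>

lemma AE_g_tau_pos: "AE \<omega> in M. 0 < g (\<tau> \<omega>) \<omega>"
proof -
  have "AE \<omega> in M. 0 < g (max 0 (fst (\<tau> \<omega>, \<omega>))) (snd (\<tau> \<omega>, \<omega>))"
  proof (rule AE_tau_G)
    fix r :: real assume r: "0 < r"
    show "AE \<omega> in M. 0 < g (max 0 (fst (r, \<omega>))) (snd (r, \<omega>))"
      using AE_increment_pos[OF order_refl r] AE_space by eventually_elim (use r g_0 in auto)
  qed measurable
  then show ?thesis using AE_space by eventually_elim (use tau_pos in \<open>auto simp: max_def less_imp_le\<close>)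
qed

text \<open>For a frozen length r only the values of \<gamma> at 0, min t r and r have to be
  compared, and each comparison is an almost sure statement about one increment.\<close>

lemma AE_Z_bounds:
  assumes t: "0 \<le> t"
  shows "AE \<omega> in M. 0 \<le> Z t \<omega> \<and> Z t \<omega> \<le> 1"
proof -
  let ?P = "\<lambda>p. 0 \<le> g (max 0 (min t (fst p))) (snd p) \<and> g (max 0 (min t (fst p))) (snd p) \<le> g (max 0 (fst p)) (snd p)"
  have [measurable]: "(\<lambda>p. g (max 0 (min t (fst p))) (snd p)) \<in> borel_measurable (borel \<Otimes>\<^sub>M G)"
    using measurable_compose[OF _ g_jointly_measurable, of "\<lambda>p. (min t (fst p), snd p)"] by simp
  have "AE \<omega> in M. ?P (\<tau> \<omega>, \<omega>)"
  proof (rule AE_tau_G)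
    fix r :: real assume r: "0 < r"
    have "AE \<omega> in M. 0 \<le> g (min t r) \<omega>"
    proof (cases "min t r = 0")
      case False
      then have "AE \<omega> in M. g 0 \<omega> < g (min t r) \<omega>" using t r by (intro AE_increment_pos) auto
      then show ?thesis using AE_space by eventually_elim (simp add: g_0)
    qed (use AE_space g_0 in \<open>auto elim!: eventually_mono\<close>)
    moreover have "AE \<omega> in M. g (min t r) \<omega> \<le> g r \<omega>"
    proof (cases "t < r")
      case True
      show ?thesis using AE_increment_pos[OF t True] by eventually_elim (use True in auto)
    qed (auto simp: min_def)
    ultimately show "AE \<omega> in M. ?P (r, \<omega>)"
      by eventually_elim (use t r in \<open>auto simp: max_def\<close>)
  qed measurable
  then show ?thesis using AE_g_tau_pos AE_space
  proof eventually_elim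
    case (elim \<omega>)
    then show ?case using tau_pos[of \<omega>] t by (auto simp: zeta_def max_def split: if_splits)
  qed
qed

text \<open>The value 0 arises from division by \<open>g (\<tau> \<omega>) \<omega> = 0\<close>.
  Since the indicator in the drift excludes both values, the drift vanishes after \<tau> at every
  \<omega>, without an exceptional set.\<close>

lemma Z_after_tau: "\<tau> \<omega> \<le> t \<Longrightarrow> Z t \<omega> = 0 \<or> Z t \<omega> = 1"
  by (auto simp: zeta_def min_def)

lemma AE_Z_after_tau: "AE \<omega> in M. \<forall>t\<ge>\<tau> \<omega>. Z t \<omega> = 1"
  using AE_g_tau_pos by eventually_elim (auto simp: zeta_def min_def)

lemma Z_0: "\<omega> \<in> space M \<Longrightarrow> Z 0 \<omega> = 0"
  using tau_pos[of \<omega>] g_0[of \<omega>] by (simp add: zeta_def min_def)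

lemma drift_coeff_after_tau: "\<tau> \<omega> \<le> t \<Longrightarrow> drift_coeff law t (Z t \<omega>) = 0"
  using Z_after_tau[of \<omega> t] by (auto simp: drift_coeff_def)

lemma Z_right_continuous:
  assumes "\<omega> \<in> space M" "0 \<le> t"
  shows "continuous (at_right t) (\<lambda>s. Z s \<omega>)"
proof (cases "t < \<tau> \<omega>")
  case True
  have "((\<lambda>s. g s \<omega> / g (\<tau> \<omega>) \<omega>) \<longlongrightarrow> g t \<omega> / g (\<tau> \<omega>) \<omega>) (at_right t)"
    using g_right_continuous[OF assms] unfolding divide_inverse
    by (intro tendsto_mult tendsto_const) (simp add: continuous_within)
  moreover have "eventually (\<lambda>s. s < \<tau> \<omega>) (at_right t)"
    using True eventually_at_right by blast
  then have "eventually (\<lambda>s. g s \<omega> / g (\<tau> \<omega>) \<omega> = Z s \<omega>) (at_right t)"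
    by eventually_elim (simp add: zeta_def min_def)
  ultimately have "((\<lambda>s. Z s \<omega>) \<longlongrightarrow> g t \<omega> / g (\<tau> \<omega>) \<omega>) (at_right t)"
    by (rule Lim_transform_eventually)
  then show ?thesis using True by (simp add: continuous_within zeta_def min_def)
next
  case False
  have "eventually (\<lambda>s. Z t \<omega> = Z s \<omega>) (at_right t)"
    using eventually_at_right_less[of t] by eventually_elim (use False in \<open>simp add: zeta_def min_def\<close>)
  then show ?thesis unfolding continuous_within
    by (rule Lim_transform_eventually[OF tendsto_const])
qed

lemma Z_measurable [measurable]:
  assumes t: "0 \<le> t"
  shows "Z t \<in> borel_measurable M"
proof -
  have "(\<lambda>\<omega>. g (max 0 (fst (min t (\<tau> \<omega>), \<omega>))) (snd (min t (\<tau> \<omega>), \<omega>))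
       / g (max 0 (fst (\<tau> \<omega>, \<omega>))) (snd (\<tau> \<omega>, \<omega>))) \<in> borel_measurable M"
    by (intro borel_measurable_divide measurable_compose[OF _ g_jointly_measurable]) measurable
  then show ?thesis
    by (rule measurable_cong[THEN iffD1, rotated]) (use t tau_pos in \<open>auto simp: zeta_def max_def less_imp_le\<close>)
qed

end

section \<open>Finite-dimensional laws of the bridge\<close>

definition partition :: "(nat \<Rightarrow> real) \<Rightarrow> nat \<Rightarrow> bool" where
  "partition ts n \<longleftrightarrow> ts 0 = 0 \<and> (\<forall>i<n. ts i < ts (Suc i))"

lemma partition_mono: "partition ts n \<Longrightarrow> i \<le> j \<Longrightarrow> j \<le> n \<Longrightarrow> ts i \<le> ts j"
proof (induction j)
  case (Suc j)
  show ?case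
  proof (cases "i = Suc j")
    case False
    then have "ts i \<le> ts j" using Suc by simp
    also have "ts j < ts (Suc j)" using Suc by (simp add: partition_def)
    finally show ?thesis by simp
  qed simp
qed simp

lemma partition_nonneg: "partition ts n \<Longrightarrow> i \<le> n \<Longrightarrow> 0 \<le> ts i"
  using partition_mono[of ts n 0 i] by (simp add: partition_def)

lemma partition_extend: "partition ts n \<Longrightarrow> ts n < u \<Longrightarrow> partition (ts(Suc n := u)) (Suc n)"
  by (auto simp: partition_def less_Suc_eq)

definition increments_law :: "(nat \<Rightarrow> real) \<Rightarrow> nat \<Rightarrow> (nat \<Rightarrow> real) measure" where
  "increments_law ts n = gamma_prod {..<n} (\<lambda>i. ts (Suc i) - ts i)"

lemma sets_increments_law [measurable_cong, simp]: "sets (increments_law ts n) = sets (PiM {..<n} (\<lambda>_. borel))"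
  by (simp add: increments_law_def)

lemma prob_space_increments_law: "partition ts n \<Longrightarrow> prob_space (increments_law ts n)"
  unfolding increments_law_def by (rule prob_space_gamma_prod) (simp add: partition_def)

lemma AE_increments_law_pos: "partition ts n \<Longrightarrow> AE x in increments_law ts n. \<forall>i<n. 0 < x i"
  unfolding increments_law_def using AE_gamma_prod_pos[of "{..<n}" "\<lambda>i. ts (Suc i) - ts i"]
  by (simp add: partition_def Ball_def)

lemma nn_integral_increments_law_extend:
  assumes [measurable]: "f \<in> borel_measurable (PiM {..<Suc n} (\<lambda>_. borel))"
  shows "(\<integral>\<^sup>+x. f x \<partial>increments_law (ts(Suc n := u)) (Suc n))
    = (\<integral>\<^sup>+x. (\<integral>\<^sup>+y. f (x(n := y)) \<partial>gamma_dist (u - ts n)) \<partial>increments_law ts n)"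
proof -
  let ?a = "\<lambda>i. (ts(Suc n := u)) (Suc i) - (ts(Suc n := u)) i"
  have "gamma_prod {..<n} ?a = gamma_prod {..<n} (\<lambda>i. ts (Suc i) - ts i)"
    unfolding gamma_prod_def by (rule PiM_cong) auto
  then show ?thesis
    using nn_integral_gamma_prod_insert[of "{..<n}" n f ?a] assms
    by (simp add: increments_law_def lessThan_Suc)
qed

context gamma_bridge
begin

text \<open>Append r as the last partition point: the value of \<gamma> at r is then the sum of all
  n + 1 independent increments, and the last of them is the remaining mass y in the normalisation
  identity.\<close>

lemma nn_integral_bridge:
  assumes ts: "partition ts n" and r: "ts n < r"
    and [measurable]: "f \<in> borel_measurable (PiM {..<n} (\<lambda>_. borel))"
  shows "(\<integral>\<^sup>+\<omega>. f (\<lambda>i\<in>{..<n}. (g (ts (Suc i)) \<omega> - g (ts i) \<omega>) / g r \<omega>) \<partial>M)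
    = (\<integral>\<^sup>+x. f x * ennreal (bridge_weight (ts n) r (\<Sum>i<n. x i)) \<partial>increments_law ts n)"
proof -
  define ts' where "ts' = ts(Suc n := r)"
  have ts': "partition ts' (Suc n)" unfolding ts'_def by (rule partition_extend[OF ts r])
  define X where "X i \<omega> = g (ts' (Suc i)) \<omega> - g (ts' i) \<omega>" for i \<omega>
  have X[measurable]: "X i \<in> borel_measurable M" if "i < Suc n" for i
    unfolding X_def using partition_nonneg[OF ts'] that
    by (intro borel_measurable_diff g_measurable) auto
  have "distr M (\<Pi>\<^sub>M i\<in>{..<Suc n}. borel) (\<lambda>\<omega>. \<lambda>i\<in>{..<Suc n}. X i \<omega>) = (\<Pi>\<^sub>M i\<in>{..<Suc n}. distr M borel (X i))"
  proof (rule indep_vars_iff_distr_eq_PiM'[THEN iffD1])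
    show "indep_vars (\<lambda>_. borel) X {..<Suc n}"
      unfolding X_def using ts' by (intro g_indep) (auto simp: partition_def)
  qed (use X in auto)
  also have "\<dots> = increments_law ts' (Suc n)"
    unfolding increments_law_def gamma_prod_def X_def
    using ts' by (intro PiM_cong distr_increment) (auto simp: partition_def intro: partition_nonneg[OF ts'])
  finally have law: "distr M (\<Pi>\<^sub>M i\<in>{..<Suc n}. borel) (\<lambda>\<omega>. \<lambda>i\<in>{..<Suc n}. X i \<omega>) = increments_law ts' (Suc n)" .
  \<comment> \<open>The vector of increments and its normalisation by the total are maps between
    product spaces; both are needed to move the integral from \<open>M\<close> to the product
    law.\<close>
  have [measurable]: "(\<lambda>\<omega>. \<lambda>i\<in>{..<Suc n}. X i \<omega>) \<in> measurable M (\<Pi>\<^sub>M i\<in>{..<Suc n}. borel)"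
    by (intro measurable_restrict X) simp
  have [measurable]: "(\<lambda>x. \<lambda>i\<in>{..<n}. x i / (\<Sum>i<Suc n. x i)) \<in> measurable (PiM {..<Suc n} (\<lambda>_. borel)) (PiM {..<n} (\<lambda>_. borel :: real measure))"
    by (intro measurable_restrict borel_measurable_divide borel_measurable_sum measurable_component_singleton) auto
  have "(\<integral>\<^sup>+\<omega>. f (\<lambda>i\<in>{..<n}. (g (ts (Suc i)) \<omega> - g (ts i) \<omega>) / g r \<omega>) \<partial>M)
    = (\<integral>\<^sup>+\<omega>. (\<lambda>x. f (\<lambda>i\<in>{..<n}. x i / (\<Sum>i<Suc n. x i))) (\<lambda>i\<in>{..<Suc n}. X i \<omega>) \<partial>M)"
  proof (intro nn_integral_cong)
    fix \<omega> assume "\<omega> \<in> space M"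
    have "(\<Sum>i<Suc n. X i \<omega>) = g (ts' (Suc n)) \<omega> - g (ts' 0) \<omega>"
      unfolding X_def by (rule sum_lessThan_telescope)
    also have "\<dots> = g r \<omega>" using ts' g_0[OF \<open>\<omega> \<in> space M\<close>] by (simp add: partition_def ts'_def)
    finally have S: "(\<Sum>i<Suc n. (\<lambda>i\<in>{..<Suc n}. X i \<omega>) i) = g r \<omega>" by simp
    have "(\<lambda>i\<in>{..<n}. (g (ts (Suc i)) \<omega> - g (ts i) \<omega>) / g r \<omega>)
       = (\<lambda>i\<in>{..<n}. (\<lambda>i\<in>{..<Suc n}. X i \<omega>) i / g r \<omega>)"
      by (rule restrict_ext) (simp add: X_def ts'_def)
    then show "f (\<lambda>i\<in>{..<n}. (g (ts (Suc i)) \<omega> - g (ts i) \<omega>) / g r \<omega>)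
       = (\<lambda>x. f (\<lambda>i\<in>{..<n}. x i / (\<Sum>i<Suc n. x i))) (\<lambda>i\<in>{..<Suc n}. X i \<omega>)"
      unfolding S by simp
  qed
  also have "\<dots> = (\<integral>\<^sup>+x. f (\<lambda>i\<in>{..<n}. x i / (\<Sum>i<Suc n. x i)) \<partial>increments_law ts' (Suc n))"
    unfolding law[symmetric] by (rule nn_integral_distr[symmetric]) measurable
  also have "\<dots> = (\<integral>\<^sup>+x. (\<integral>\<^sup>+y. f (\<lambda>i\<in>{..<n}. (x(n := y)) i / (\<Sum>i<Suc n. (x(n := y)) i)) \<partial>gamma_dist (r - ts n)) \<partial>increments_law ts n)"
    unfolding ts'_def by (rule nn_integral_increments_law_extend) measurable
  also have "\<dots> = (\<integral>\<^sup>+x. (\<integral>\<^sup>+y. f (\<lambda>i\<in>{..<n}. x i / ((\<Sum>i<n. x i) + y)) \<partial>gamma_dist (r - ts n)) \<partial>increments_law ts n)"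
  proof (intro nn_integral_cong arg_cong[where f=f])
    fix x :: "nat \<Rightarrow> real" and y
    have "(\<Sum>i<Suc n. (x(n := y)) i) = (\<Sum>i<n. x i) + y" by simp
    then show "(\<lambda>i\<in>{..<n}. (x(n := y)) i / (\<Sum>i<Suc n. (x(n := y)) i)) = (\<lambda>i\<in>{..<n}. x i / ((\<Sum>i<n. x i) + y))"
      by (intro restrict_ext) simp
  qed
  also have "\<dots> = (\<integral>\<^sup>+x. f x * ennreal (bridge_weight (ts n) r (\<Sum>i<n. x i)) \<partial>increments_law ts n)"
    unfolding increments_law_def
  proof (rule nn_integral_gamma_prod_normalise)
    show "ts n = (\<Sum>i<n. ts (Suc i) - ts i)"
      using ts by (subst sum_lessThan_telescope) (simp add: partition_def)
  qed (use ts r in \<open>auto simp: partition_def\<close>)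
  finally show ?thesis .
qed

definition Z_increments :: "(nat \<Rightarrow> real) \<Rightarrow> nat \<Rightarrow> 'a \<Rightarrow> nat \<Rightarrow> real" where
  "Z_increments ts n \<omega> = (\<lambda>i\<in>{..<n}. Z (ts (Suc i)) \<omega> - Z (ts i) \<omega>)"

lemma Z_increments_measurable [measurable]:
  assumes "partition ts n"
  shows "Z_increments ts n \<in> measurable M (PiM {..<n} (\<lambda>_. borel))"
  unfolding Z_increments_def using partition_nonneg[OF assms]
  by (intro measurable_restrict borel_measurable_diff Z_measurable) auto

text \<open>Freeze \<tau> at r and apply the bridge density. The reference law of the increments is
  the same for every r, so Tonelli's theorem can bring the integral over r inside; for given
  increments x, that inner integral is the unnormalised posterior of \<tau>. The restriction to
  \<open>ts n < \<tau> \<omega>\<close> is where the density exists.\<close>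

lemma nn_integral_tau_Z:
  assumes ts: "partition ts n"
    and [measurable]: "\<psi> \<in> borel_measurable (borel \<Otimes>\<^sub>M borel)" "h \<in> borel_measurable (PiM {..<n} (\<lambda>_. borel))"
  shows "(\<integral>\<^sup>+\<omega>. (if ts n < \<tau> \<omega> then \<psi> (\<tau> \<omega>, Z (ts n) \<omega>) * h (Z_increments ts n \<omega>) else 0) \<partial>M)
    = (\<integral>\<^sup>+x. h x * (\<integral>\<^sup>+r. (if ts n < r then \<psi> (r, \<Sum>i<n. x i) * ennreal (bridge_weight (ts n) r (\<Sum>i<n. x i)) else 0) \<partial>law)
         \<partial>increments_law ts n)"
proof -
  note nonneg = partition_nonneg[OF ts]
  have le: "ts i \<le> ts n" if "i \<le> n" for i using partition_mono[OF ts that order_refl] .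
  interpret L: prob_space "increments_law ts n" by (rule prob_space_increments_law[OF ts])
  interpret PL: pair_sigma_finite law "increments_law ts n" ..
  \<comment> \<open>For r beyond \<open>ts n\<close> the \<open>max 0\<close> has no effect; it
    makes the quotient jointly measurable over all real r.\<close>
  let ?X = "\<lambda>r \<omega>. \<lambda>i\<in>{..<n}. (g (ts (Suc i)) \<omega> - g (ts i) \<omega>) / g (max 0 r) \<omega>"
  let ?f = "\<lambda>p. if ts n < fst p then \<psi> (fst p, \<Sum>i<n. ?X (fst p) (snd p) i) * h (?X (fst p) (snd p)) else 0"
  have gts: "(\<lambda>p. g (ts i) (snd p)) \<in> borel_measurable (borel \<Otimes>\<^sub>M G)" if "i \<le> n" for i
    by (rule measurable_compose[OF measurable_snd g_measurable_G[OF nonneg[OF that]]])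
  have Xm[measurable]: "(\<lambda>p. ?X (fst p) (snd p)) \<in> measurable (borel \<Otimes>\<^sub>M G) (PiM {..<n} (\<lambda>_. borel))"
    by (intro measurable_restrict borel_measurable_divide borel_measurable_diff gts g_jointly_measurable) auto
  have Sm[measurable]: "(\<lambda>p. \<Sum>i<n. ?X (fst p) (snd p) i) \<in> borel_measurable (borel \<Otimes>\<^sub>M G)"
    by (intro borel_measurable_sum measurable_compose[OF Xm measurable_component_singleton]) auto
  have fm: "?f \<in> borel_measurable (borel \<Otimes>\<^sub>M G)" by measurable
  have "(\<integral>\<^sup>+\<omega>. (if ts n < \<tau> \<omega> then \<psi> (\<tau> \<omega>, Z (ts n) \<omega>) * h (Z_increments ts n \<omega>) else 0) \<partial>M)
     = (\<integral>\<^sup>+\<omega>. ?f (\<tau> \<omega>, \<omega>) \<partial>M)"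
  proof (intro nn_integral_cong)
    fix \<omega> assume \<omega>: "\<omega> \<in> space M"
    show "(if ts n < \<tau> \<omega> then \<psi> (\<tau> \<omega>, Z (ts n) \<omega>) * h (Z_increments ts n \<omega>) else 0) = ?f (\<tau> \<omega>, \<omega>)"
    proof (cases "ts n < \<tau> \<omega>")
      case True
      have Zg: "Z (ts i) \<omega> = g (ts i) \<omega> / g (max 0 (\<tau> \<omega>)) \<omega>" if "i \<le> n" for i
        using le[OF that] True tau_pos[OF \<omega>] by (simp add: zeta_def min_def max_def)
      have inc: "Z_increments ts n \<omega> = ?X (\<tau> \<omega>) \<omega>"
        unfolding Z_increments_def by (intro restrict_ext) (simp add: Zg diff_divide_distrib)
      have "(\<Sum>i<n. ?X (\<tau> \<omega>) \<omega> i) = (\<Sum>i<n. Z (ts (Suc i)) \<omega> - Z (ts i) \<omega>)"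
        unfolding inc[symmetric] Z_increments_def by simp
      also have "\<dots> = Z (ts n) \<omega>"
        using ts Z_0[OF \<omega>] by (subst sum_lessThan_telescope) (simp add: partition_def)
      finally show ?thesis using True inc by simp
    qed simp
  qed
  also have "\<dots> = (\<integral>\<^sup>+r. (\<integral>\<^sup>+\<omega>. ?f (r, \<omega>) \<partial>M) \<partial>law)"
    by (rule nn_integral_tau_G[OF fm])
  also have "\<dots> = (\<integral>\<^sup>+r. (\<integral>\<^sup>+x. (if ts n < r then \<psi> (r, \<Sum>i<n. x i) * h x * ennreal (bridge_weight (ts n) r (\<Sum>i<n. x i)) else 0)
       \<partial>increments_law ts n) \<partial>law)"
  proof (rule nn_integral_cong)
    fix r
    show "(\<integral>\<^sup>+\<omega>. ?f (r, \<omega>) \<partial>M) = (\<integral>\<^sup>+x. (if ts n < r then \<psi> (r, \<Sum>i<n. x i) * h x * ennreal (bridge_weight (ts n) r (\<Sum>i<n. x i)) else 0)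
       \<partial>increments_law ts n)"
    proof (cases "ts n < r")
      case True
      have "max 0 r = r" using True nonneg[of n] by simp
      then have "(\<integral>\<^sup>+\<omega>. ?f (r, \<omega>) \<partial>M) = (\<integral>\<^sup>+\<omega>. (\<lambda>x. \<psi> (r, \<Sum>i<n. x i) * h x) (\<lambda>i\<in>{..<n}. (g (ts (Suc i)) \<omega> - g (ts i) \<omega>) / g r \<omega>) \<partial>M)"
        using True by simp
      also have "\<dots> = (\<integral>\<^sup>+x. \<psi> (r, \<Sum>i<n. x i) * h x * ennreal (bridge_weight (ts n) r (\<Sum>i<n. x i)) \<partial>increments_law ts n)"
        by (rule nn_integral_bridge[OF ts True]) measurable
      finally show ?thesis using True by simp
    qed simp
  qed
  also have "\<dots> = (\<integral>\<^sup>+x. (\<integral>\<^sup>+r. (if ts n < r then \<psi> (r, \<Sum>i<n. x i) * h x * ennreal (bridge_weight (ts n) r (\<Sum>i<n. x i)) else 0)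
       \<partial>law) \<partial>increments_law ts n)"
    by (rule PL.Fubini'[symmetric]) measurable
  also have "\<dots> = (\<integral>\<^sup>+x. h x * (\<integral>\<^sup>+r. (if ts n < r then \<psi> (r, \<Sum>i<n. x i) * ennreal (bridge_weight (ts n) r (\<Sum>i<n. x i)) else 0) \<partial>law)
         \<partial>increments_law ts n)"
  proof (rule nn_integral_cong)
    fix x
    have "(\<integral>\<^sup>+r. (if ts n < r then \<psi> (r, \<Sum>i<n. x i) * h x * ennreal (bridge_weight (ts n) r (\<Sum>i<n. x i)) else 0) \<partial>law)
      = (\<integral>\<^sup>+r. h x * (if ts n < r then \<psi> (r, \<Sum>i<n. x i) * ennreal (bridge_weight (ts n) r (\<Sum>i<n. x i)) else 0) \<partial>law)"
      by (intro nn_integral_cong) (simp add: mult_ac)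
    also have "\<dots> = h x * (\<integral>\<^sup>+r. (if ts n < r then \<psi> (r, \<Sum>i<n. x i) * ennreal (bridge_weight (ts n) r (\<Sum>i<n. x i)) else 0) \<partial>law)"
      by (rule nn_integral_cmult) measurable
    finally show "(\<integral>\<^sup>+r. (if ts n < r then \<psi> (r, \<Sum>i<n. x i) * h x * ennreal (bridge_weight (ts n) r (\<Sum>i<n. x i)) else 0) \<partial>law) = \<dots>" .
  qed
  finally show ?thesis .
qed

section \<open>One-step identities for the drift and the bridge\<close>

lemma nn_integral_drift_coeff:
  assumes ts: "partition ts n" and pos: "0 < ts n"
    and h[measurable]: "h \<in> borel_measurable (PiM {..<n} (\<lambda>_. borel))"
  shows "(\<integral>\<^sup>+\<omega>. (if ts n < \<tau> \<omega> then ennreal (drift_coeff law (ts n) (Z (ts n) \<omega>)) * h (Z_increments ts n \<omega>) else 0) \<partial>M)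
    = (\<integral>\<^sup>+\<omega>. (if ts n < \<tau> \<omega> then ennreal (1 - Z (ts n) \<omega>) * ennreal (1 / (\<tau> \<omega> - ts n)) * h (Z_increments ts n \<omega>) else 0) \<partial>M)"
proof -
  \<comment> \<open>Bayes' rule requires a strictly positive state; the state is the sum of the
    increments, which is positive only if there is at least one.\<close>
  have n: "0 < n" using ts pos by (cases n) (auto simp: partition_def)
  have [measurable]: "drift_coeff law (ts n) \<in> borel_measurable borel"
    using measurable_compose[OF measurable_Pair1' law.borel_measurable_drift_coeff, of "ts n"] by simp
  let ?W = "\<lambda>r x. ennreal (bridge_weight (ts n) r (\<Sum>i<n. x i))"
  have "(\<integral>\<^sup>+\<omega>. (if ts n < \<tau> \<omega> then ennreal (drift_coeff law (ts n) (Z (ts n) \<omega>)) * h (Z_increments ts n \<omega>) else 0) \<partial>M)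
    = (\<integral>\<^sup>+x. h x * (\<integral>\<^sup>+r. (if ts n < r then ennreal (drift_coeff law (ts n) (\<Sum>i<n. x i)) * ?W r x else 0) \<partial>law) \<partial>increments_law ts n)"
    using nn_integral_tau_Z[OF ts _ h, of "\<lambda>p. ennreal (drift_coeff law (ts n) (snd p))"] by (simp cong: if_cong)
  also have "\<dots> = (\<integral>\<^sup>+x. h x * (\<integral>\<^sup>+r. (if ts n < r then ennreal (1 - (\<Sum>i<n. x i)) * ennreal (1 / (r - ts n)) * ?W r x else 0) \<partial>law) \<partial>increments_law ts n)"
  proof (rule nn_integral_cong_AE)
    show "AE x in increments_law ts n. h x * (\<integral>\<^sup>+r. (if ts n < r then ennreal (drift_coeff law (ts n) (\<Sum>i<n. x i)) * ?W r x else 0) \<partial>law)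
      = h x * (\<integral>\<^sup>+r. (if ts n < r then ennreal (1 - (\<Sum>i<n. x i)) * ennreal (1 / (r - ts n)) * ?W r x else 0) \<partial>law)"
      using AE_increments_law_pos[OF ts]
    proof eventually_elim
      case (elim x)
      then have "0 < (\<Sum>i<n. x i)" using n by (intro sum_pos) auto
      show ?case
      proof (cases "(\<Sum>i<n. x i) < 1")
        case True
        show ?thesis
          by (rule arg_cong[where f="(*) (h x)"], rule law.drift_coeff_bayes) fact+
      next
        case False
        then have "?W r x = 0" for r by (simp add: bridge_weight_def)
        then show ?thesis by (simp cong: if_cong)
      qed
    qed
  qed
  also have "\<dots> = (\<integral>\<^sup>+\<omega>. (if ts n < \<tau> \<omega> then ennreal (1 - Z (ts n) \<omega>) * ennreal (1 / (\<tau> \<omega> - ts n)) * h (Z_increments ts n \<omega>) else 0) \<partial>M)"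
    using nn_integral_tau_Z[OF ts _ h, of "\<lambda>p. ennreal (1 - snd p) * ennreal (1 / (fst p - ts n))"] by (simp cong: if_cong)
  finally show ?thesis .
qed

text \<open>Append u to the partition and integrate out the last increment with the Beta identity.
  That identity holds for each length r separately, so an arbitrary factor
  \<open>q (\<tau> \<omega>)\<close> may be carried along: it is 1 for the process itself and 1 /
  (\<tau> - u) for the drift.\<close>

lemma nn_integral_one_minus_Z_step:
  assumes ts: "partition ts n" and u: "ts n < u"
    and q[measurable]: "q \<in> borel_measurable borel" and h[measurable]: "h \<in> borel_measurable (PiM {..<n} (\<lambda>_. borel))"
  shows "(\<integral>\<^sup>+\<omega>. (if u < \<tau> \<omega> then ennreal (1 - Z u \<omega>) * q (\<tau> \<omega>) * h (Z_increments ts n \<omega>) else 0) \<partial>M)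
    = (\<integral>\<^sup>+\<omega>. (if u < \<tau> \<omega> then ennreal ((\<tau> \<omega> - u) / (\<tau> \<omega> - ts n)) * ennreal (1 - Z (ts n) \<omega>) * q (\<tau> \<omega>) * h (Z_increments ts n \<omega>) else 0) \<partial>M)"
proof -
  define ts' where "ts' = ts(Suc n := u)"
  have ts': "partition ts' (Suc n)" unfolding ts'_def by (rule partition_extend[OF ts u])
  have u0: "0 \<le> ts n" using partition_nonneg[OF ts] by simp
  interpret L: prob_space "increments_law ts n" by (rule prob_space_increments_law[OF ts])
  interpret Gd: sigma_finite_measure "gamma_dist (u - ts n)" by (rule sigma_finite_gamma_dist)
  interpret PL: pair_sigma_finite law "gamma_dist (u - ts n)" ..
  let ?h' = "\<lambda>x. h (restrict x {..<n})"
  have h'[measurable]: "?h' \<in> borel_measurable (PiM {..<Suc n} (\<lambda>_. borel))"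
    by (rule measurable_compose[OF measurable_restrict_subset h]) auto
  have inc: "restrict (Z_increments ts' (Suc n) \<omega>) {..<n} = Z_increments ts n \<omega>" for \<omega>
    unfolding Z_increments_def restrict_restrict by (auto simp: ts'_def fun_eq_iff restrict_def)
  let ?F = "\<lambda>z. \<integral>\<^sup>+r. (if u < r then ennreal (1 - z) * q r * ennreal (bridge_weight u r z) else 0) \<partial>law"
  have F[measurable]: "?F \<in> borel_measurable borel"
    by (rule law.borel_measurable_nn_integral) measurable
  have tsu: "ts' (Suc n) = u" by (simp add: ts'_def)
  have "(\<integral>\<^sup>+\<omega>. (if u < \<tau> \<omega> then ennreal (1 - Z u \<omega>) * q (\<tau> \<omega>) * h (Z_increments ts n \<omega>) else 0) \<partial>M)
     = (\<integral>\<^sup>+x. ?h' x * ?F (\<Sum>i<Suc n. x i) \<partial>increments_law ts' (Suc n))"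
    using nn_integral_tau_Z[OF ts' _ h', of "\<lambda>p. ennreal (1 - snd p) * q (fst p)"]
    unfolding inc tsu by (simp del: sum.lessThan_Suc cong: if_cong)
  also have "\<dots> = (\<integral>\<^sup>+x. (\<integral>\<^sup>+y. ?h' (x(n := y)) * ?F (\<Sum>i<Suc n. (x(n := y)) i) \<partial>gamma_dist (u - ts n)) \<partial>increments_law ts n)"
    unfolding ts'_def by (rule nn_integral_increments_law_extend) measurable
  also have "\<dots> = (\<integral>\<^sup>+x. h x * (\<integral>\<^sup>+r. (if ts n < r then
       (if u < r then ennreal ((r - u) / (r - ts n)) * ennreal (1 - (\<Sum>i<n. x i)) * q r else 0) * ennreal (bridge_weight (ts n) r (\<Sum>i<n. x i)) else 0) \<partial>law)
         \<partial>increments_law ts n)"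
  proof (rule nn_integral_cong)
    fix x assume "x \<in> space (increments_law ts n)"
    then have x: "x \<in> extensional {..<n}"
      by (simp add: increments_law_def gamma_prod_def space_PiM PiE_def)
    have rx: "restrict (x(n := y)) {..<n} = x" for y
      using x by (auto simp: fun_eq_iff restrict_def extensional_def)
    let ?S = "\<Sum>i<n. x i"
    have sx: "(\<Sum>i<Suc n. (x(n := y)) i) = ?S + y" for y by simp
    have "(\<integral>\<^sup>+y. ?h' (x(n := y)) * ?F (\<Sum>i<Suc n. (x(n := y)) i) \<partial>gamma_dist (u - ts n))
       = (\<integral>\<^sup>+y. h x * ?F (?S + y) \<partial>gamma_dist (u - ts n))"
      unfolding rx sx ..
    also have "\<dots> = h x * (\<integral>\<^sup>+y. ?F (?S + y) \<partial>gamma_dist (u - ts n))"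
      by (rule nn_integral_cmult) measurable
    also have "(\<integral>\<^sup>+y. ?F (?S + y) \<partial>gamma_dist (u - ts n))
       = (\<integral>\<^sup>+r. (\<integral>\<^sup>+y. (if u < r then ennreal (1 - (?S + y)) * q r * ennreal (bridge_weight u r (?S + y)) else 0) \<partial>gamma_dist (u - ts n)) \<partial>law)"
      by (rule PL.Fubini') measurable
    also have "\<dots> = (\<integral>\<^sup>+r. (if ts n < r then
       (if u < r then ennreal ((r - u) / (r - ts n)) * ennreal (1 - ?S) * q r else 0) * ennreal (bridge_weight (ts n) r ?S) else 0) \<partial>law)"
    proof (rule nn_integral_cong)
      fix r
      show "(\<integral>\<^sup>+y. (if u < r then ennreal (1 - (?S + y)) * q r * ennreal (bridge_weight u r (?S + y)) else 0) \<partial>gamma_dist (u - ts n))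
        = (if ts n < r then (if u < r then ennreal ((r - u) / (r - ts n)) * ennreal (1 - ?S) * q r else 0) * ennreal (bridge_weight (ts n) r ?S) else 0)"
      proof (cases "u < r")
        case True
        have "(\<integral>\<^sup>+y. ennreal (1 - (?S + y)) * q r * ennreal (bridge_weight u r (?S + y)) \<partial>gamma_dist (u - ts n))
          = (\<integral>\<^sup>+y. q r * (ennreal (1 - (?S + y)) * ennreal (bridge_weight u r (?S + y))) \<partial>gamma_dist (u - ts n))"
          by (intro nn_integral_cong) (simp add: mult_ac)
        also have "\<dots> = q r * (\<integral>\<^sup>+y. ennreal (1 - (?S + y)) * ennreal (bridge_weight u r (?S + y)) \<partial>gamma_dist (u - ts n))"
          by (rule nn_integral_cmult) measurable
        also have "\<dots> = q r * (ennreal ((r - u) / (r - ts n)) * (ennreal (1 - ?S) * ennreal (bridge_weight (ts n) r ?S)))"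
          by (subst nn_integral_bridge_weight_step[OF u0 u True]) (rule refl)
        finally show ?thesis using True u by (simp add: mult_ac)
      qed simp
    qed
    finally show "(\<integral>\<^sup>+y. ?h' (x(n := y)) * ?F (\<Sum>i<Suc n. (x(n := y)) i) \<partial>gamma_dist (u - ts n))
      = h x * (\<integral>\<^sup>+r. (if ts n < r then
       (if u < r then ennreal ((r - u) / (r - ts n)) * ennreal (1 - ?S) * q r else 0) * ennreal (bridge_weight (ts n) r ?S) else 0) \<partial>law)" .
  qed
  also have "\<dots> = (\<integral>\<^sup>+\<omega>. (if ts n < \<tau> \<omega> then (if u < \<tau> \<omega> then ennreal ((\<tau> \<omega> - u) / (\<tau> \<omega> - ts n)) * ennreal (1 - Z (ts n) \<omega>) * q (\<tau> \<omega>) else 0)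
       * h (Z_increments ts n \<omega>) else 0) \<partial>M)"
    using nn_integral_tau_Z[OF ts _ h, of "\<lambda>p. if u < fst p then ennreal ((fst p - u) / (fst p - ts n)) * ennreal (1 - snd p) * q (fst p) else 0"]
    by (simp cong: if_cong)
  also have "\<dots> = (\<integral>\<^sup>+\<omega>. (if u < \<tau> \<omega> then ennreal ((\<tau> \<omega> - u) / (\<tau> \<omega> - ts n)) * ennreal (1 - Z (ts n) \<omega>) * q (\<tau> \<omega>) * h (Z_increments ts n \<omega>) else 0) \<partial>M)"
    using u by (intro nn_integral_cong) auto
  finally show ?thesis .
qed

text \<open>The factor \<tau> - u gained from the bridge cancels the singular 1 / (\<tau> - u) of
  the drift. On u < \<tau> the integrand no longer depends on u, so the later integration over time
  only measures an interval.\<close>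

lemma nn_integral_drift_coeff_step:
  assumes ts: "partition ts n" and u: "ts n < u"
    and h[measurable]: "h \<in> borel_measurable (PiM {..<n} (\<lambda>_. borel))"
  shows "(\<integral>\<^sup>+\<omega>. ennreal (drift_coeff law u (Z u \<omega>)) * h (Z_increments ts n \<omega>) \<partial>M)
    = (\<integral>\<^sup>+\<omega>. (if u < \<tau> \<omega> then ennreal (1 - Z (ts n) \<omega>) * ennreal (1 / (\<tau> \<omega> - ts n)) * h (Z_increments ts n \<omega>) else 0) \<partial>M)"
proof -
  define ts' where "ts' = ts(Suc n := u)"
  have ts': "partition ts' (Suc n)" unfolding ts'_def by (rule partition_extend[OF ts u])
  have tsu: "ts' (Suc n) = u" by (simp add: ts'_def)
  have u0: "0 < u" using partition_nonneg[OF ts, of n] u by simp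
  let ?h' = "\<lambda>x. h (restrict x {..<n})"
  have h': "?h' \<in> borel_measurable (PiM {..<Suc n} (\<lambda>_. borel))"
    by (rule measurable_compose[OF measurable_restrict_subset h]) auto
  have inc: "restrict (Z_increments ts' (Suc n) \<omega>) {..<n} = Z_increments ts n \<omega>" for \<omega>
    unfolding Z_increments_def restrict_restrict by (auto simp: ts'_def fun_eq_iff restrict_def)
  have "(\<integral>\<^sup>+\<omega>. ennreal (drift_coeff law u (Z u \<omega>)) * h (Z_increments ts n \<omega>) \<partial>M)
    = (\<integral>\<^sup>+\<omega>. (if u < \<tau> \<omega> then ennreal (drift_coeff law u (Z u \<omega>)) * h (Z_increments ts n \<omega>) else 0) \<partial>M)"
    by (intro nn_integral_cong) (auto simp: drift_coeff_after_tau)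
  also have "\<dots> = (\<integral>\<^sup>+\<omega>. (if u < \<tau> \<omega> then ennreal (1 - Z u \<omega>) * ennreal (1 / (\<tau> \<omega> - u)) * h (Z_increments ts n \<omega>) else 0) \<partial>M)"
    using nn_integral_drift_coeff[OF ts' _ h'] u0 unfolding inc tsu by simp
  also have "\<dots> = (\<integral>\<^sup>+\<omega>. (if u < \<tau> \<omega> then ennreal ((\<tau> \<omega> - u) / (\<tau> \<omega> - ts n)) * ennreal (1 - Z (ts n) \<omega>) * ennreal (1 / (\<tau> \<omega> - u)) * h (Z_increments ts n \<omega>) else 0) \<partial>M)"
    by (rule nn_integral_one_minus_Z_step[OF ts u _ h]) measurable
  also have "\<dots> = (\<integral>\<^sup>+\<omega>. (if u < \<tau> \<omega> then ennreal (1 - Z (ts n) \<omega>) * ennreal (1 / (\<tau> \<omega> - ts n)) * h (Z_increments ts n \<omega>) else 0) \<partial>M)"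
  proof (intro nn_integral_cong)
    fix \<omega>
    have "ennreal ((\<tau> \<omega> - u) / (\<tau> \<omega> - ts n)) * ennreal (1 / (\<tau> \<omega> - u)) = ennreal (1 / (\<tau> \<omega> - ts n))" if "u < \<tau> \<omega>"
      using that u by (simp add: ennreal_mult[symmetric])
    then show "(if u < \<tau> \<omega> then ennreal ((\<tau> \<omega> - u) / (\<tau> \<omega> - ts n)) * ennreal (1 - Z (ts n) \<omega>) * ennreal (1 / (\<tau> \<omega> - u)) * h (Z_increments ts n \<omega>) else 0)
      = (if u < \<tau> \<omega> then ennreal (1 - Z (ts n) \<omega>) * ennreal (1 / (\<tau> \<omega> - ts n)) * h (Z_increments ts n \<omega>) else 0)"
      by (smt (verit) mult.assoc mult.commute)
  qed
  finally show ?thesis .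
qed

end

section \<open>The compensator\<close>

lemma partition_of_finite_set:
  assumes J: "finite J" "J \<subseteq> {0..s}" "0 \<in> J" "s \<in> J"
  obtains ts n where "partition ts n" "ts n = s" "ts ` {..n} = J"
proof -
  define L where "L = sorted_list_of_set J"
  define n where "n = length L - 1"
  have setL: "set L = J" using J by (simp add: L_def)
  have "L \<noteq> []" using setL J by auto
  then have len: "length L = Suc n" by (simp add: n_def)
  have less: "L ! i < L ! j" if "i < j" "j \<le> n" for i j
    using sorted_wrt_nth_less[of "(<)" L i j] that len by (simp add: L_def)
  have img: "(!) L ` {..n} = J"
    unfolding setL[symmetric] set_conv_nth len by (auto simp: less_Suc_eq_le)
  have "L ! 0 \<in> J" "L ! n \<in> J" using img by auto
  then have bnd: "0 \<le> L ! 0" "L ! n \<le> s" using J by auto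
  have "L ! 0 = 0"
  proof -
    obtain i where "i \<le> n" "L ! i = 0" using img J(3) by (metis imageE atMost_iff)
    then show ?thesis using less[of 0 i] bnd by (cases "i = 0") auto
  qed
  moreover have "L ! n = s"
  proof -
    obtain i where "i \<le> n" "L ! i = s" using img J(4) by (metis imageE atMost_iff)
    then show ?thesis using less[of i n] bnd by (cases "i = n") auto
  qed
  ultimately show thesis
    using less img by (intro that[of "(!) L" n]) (auto simp: partition_def)
qed

lemma nn_integral_const_before:
  fixes s t r :: real
  assumes "s < t"
  shows "(\<integral>\<^sup>+u. (if s < u \<and> u \<le> t \<and> u < r then c else 0) \<partial>lborel) = (if s < r then c * ennreal (min t r - s) else 0)"
proof -
  let ?I = "{u. s < u \<and> u \<le> t \<and> u < r}"
  have I: "?I = (if s < r then if t < r then {s<..t} else {s<..<r} else {})" by auto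
  have "(\<integral>\<^sup>+u. (if s < u \<and> u \<le> t \<and> u < r then c else 0) \<partial>lborel) = (\<integral>\<^sup>+u. c * indicator ?I u \<partial>lborel)"
    by (intro nn_integral_cong) (auto simp: indicator_def)
  also have "\<dots> = c * emeasure lborel ?I"
    by (rule nn_integral_cmult_indicator) (simp add: I)
  also have "\<dots> = (if s < r then c * ennreal (min t r - s) else 0)"
    unfolding I using assms by auto
  finally show ?thesis .
qed

context gamma_bridge
begin

lemma Z_jointly_measurable [measurable]:
  "(\<lambda>p. Z (max 0 (fst p)) (snd p)) \<in> borel_measurable (borel \<Otimes>\<^sub>M M)"
  using right_continuous_jointly_measurable[of Z M] by (simp add: Z_right_continuous split_beta')

text \<open>An extended-valued integrated drift, defined and open to Tonelli's theorem before
  finiteness is known. \<open>max 0 u\<close> matches the form in which joint measurability of the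
  process is stated.\<close>

definition drift_integral :: "real \<Rightarrow> real \<Rightarrow> 'a \<Rightarrow> ennreal" where
  "drift_integral s t \<omega> = (\<integral>\<^sup>+u. (if s < u \<and> u \<le> t then ennreal (drift_coeff law u (Z (max 0 u) \<omega>)) else 0) \<partial>lborel)"

lemma drift_coeff_Z_measurable [measurable]:
  "(\<lambda>p. drift_coeff law (fst p) (Z (max 0 (fst p)) (snd p))) \<in> borel_measurable (borel \<Otimes>\<^sub>M M)"
  using measurable_compose[OF _ law.borel_measurable_drift_coeff, of "\<lambda>p. (fst p, Z (max 0 (fst p)) (snd p))"]
  by simp

lemma drift_coeff_Z_measurable' [measurable]:
  "(\<lambda>p. drift_coeff law (snd p) (Z (max 0 (snd p)) (fst p))) \<in> borel_measurable (M \<Otimes>\<^sub>M borel)"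
  using measurable_compose[OF _ drift_coeff_Z_measurable, of "\<lambda>p. (snd p, fst p)"] by simp

lemma drift_integral_measurable [measurable]: "drift_integral s t \<in> borel_measurable M"
proof -
  have "(\<lambda>\<omega>. drift_integral s t \<omega>) \<in> borel_measurable M"
    unfolding drift_integral_def by (rule lborel.borel_measurable_nn_integral) measurable
  then show ?thesis .
qed

text \<open>With s for \<open>ts n\<close>: on t < \<tau> the process contributes the weight (\<tau>
  - t) / (\<tau> - s), on s < \<tau> the drift contributes (min t \<tau> - s) / (\<tau> - s), and
  these add up to 1. Writing the identity as a sum avoids subtraction of possibly infinite
  quantities.\<close>

lemma nn_integral_compensator:
  assumes ts: "partition ts n" and st: "ts n \<le> t"
    and h[measurable]: "h \<in> borel_measurable (PiM {..<n} (\<lambda>_. borel))"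
  shows "(\<integral>\<^sup>+\<omega>. ennreal (1 - Z t \<omega>) * h (Z_increments ts n \<omega>) \<partial>M)
      + (\<integral>\<^sup>+\<omega>. drift_integral (ts n) t \<omega> * h (Z_increments ts n \<omega>) \<partial>M)
    = (\<integral>\<^sup>+\<omega>. ennreal (1 - Z (ts n) \<omega>) * h (Z_increments ts n \<omega>) \<partial>M)"
proof (cases "ts n < t")
  case False
  have "drift_integral (ts n) t \<omega> = (\<integral>\<^sup>+u. 0 \<partial>(lborel :: real measure))" for \<omega>
    unfolding drift_integral_def using False by (intro nn_integral_cong) auto
  then have 0: "drift_integral (ts n) t \<omega> = 0" for \<omega> by simp
  have t: "t = ts n" using False st by linarith
  show ?thesis unfolding 0 unfolding t by simp
next
  case True
  define s where "s = ts n"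
  have s0: "0 \<le> s" and st: "s < t" using partition_nonneg[OF ts, of n] True by (auto simp: s_def)
  let ?h = "\<lambda>\<omega>. h (Z_increments ts n \<omega>)"
  have hm[measurable]: "?h \<in> borel_measurable M"
    by (rule measurable_compose[OF Z_increments_measurable[OF ts] h])
  have Zm[measurable]: "Z s \<in> borel_measurable M" "Z t \<in> borel_measurable M" using s0 st by auto
  let ?c = "\<lambda>\<omega>. ennreal (1 - Z s \<omega>) * ennreal (1 / (\<tau> \<omega> - s)) * ?h \<omega>"
  interpret PL: pair_sigma_finite lborel M ..
  \<comment> \<open>From \<tau> on, 1 - \<zeta> is almost surely 0; this restricts the integrals to
    v < \<tau>, where the density formula applies.\<close>
  have before: "(\<integral>\<^sup>+\<omega>. ennreal (1 - Z v \<omega>) * ?h \<omega> \<partial>M) = (\<integral>\<^sup>+\<omega>. (if v < \<tau> \<omega> then ennreal (1 - Z v \<omega>) * ?h \<omega> else 0) \<partial>M)" for v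
    using AE_Z_after_tau by (intro nn_integral_cong_AE) (auto elim!: eventually_mono)
  have E1: "(\<integral>\<^sup>+\<omega>. ennreal (1 - Z t \<omega>) * ?h \<omega> \<partial>M)
     = (\<integral>\<^sup>+\<omega>. (if t < \<tau> \<omega> then ennreal ((\<tau> \<omega> - t) / (\<tau> \<omega> - s)) * ennreal (1 - Z s \<omega>) * ?h \<omega> else 0) \<partial>M)"
    unfolding before using nn_integral_one_minus_Z_step[OF ts True _ h, of "\<lambda>_. 1"] by (simp add: s_def cong: if_cong)
  have "(\<integral>\<^sup>+\<omega>. drift_integral s t \<omega> * ?h \<omega> \<partial>M)
     = (\<integral>\<^sup>+\<omega>. (\<integral>\<^sup>+u. (if s < u \<and> u \<le> t then ennreal (drift_coeff law u (Z (max 0 u) \<omega>)) * ?h \<omega> else 0) \<partial>lborel) \<partial>M)"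
  proof (rule nn_integral_cong)
    fix \<omega> assume \<omega>: "\<omega> \<in> space M"
    have [measurable]: "(\<lambda>u. drift_coeff law u (Z (max 0 u) \<omega>)) \<in> borel_measurable borel"
      using measurable_compose[OF measurable_Pair2'[OF \<omega>] drift_coeff_Z_measurable] by simp
    have "drift_integral s t \<omega> * ?h \<omega>
       = (\<integral>\<^sup>+u. (if s < u \<and> u \<le> t then ennreal (drift_coeff law u (Z (max 0 u) \<omega>)) else 0) * ?h \<omega> \<partial>lborel)"
      unfolding drift_integral_def by (rule nn_integral_multc[symmetric]) measurable
    also have "\<dots> = (\<integral>\<^sup>+u. (if s < u \<and> u \<le> t then ennreal (drift_coeff law u (Z (max 0 u) \<omega>)) * ?h \<omega> else 0) \<partial>lborel)"
      by (intro nn_integral_cong) auto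
    finally show "drift_integral s t \<omega> * ?h \<omega> = \<dots>" .
  qed
  also have "\<dots> = (\<integral>\<^sup>+u. (\<integral>\<^sup>+\<omega>. (if s < u \<and> u \<le> t then ennreal (drift_coeff law u (Z (max 0 u) \<omega>)) * ?h \<omega> else 0) \<partial>M) \<partial>lborel)"
    by (rule PL.Fubini') measurable
  also have "\<dots> = (\<integral>\<^sup>+u. (\<integral>\<^sup>+\<omega>. (if s < u \<and> u \<le> t \<and> u < \<tau> \<omega> then ?c \<omega> else 0) \<partial>M) \<partial>lborel)"
  proof (rule nn_integral_cong)
    fix u
    show "(\<integral>\<^sup>+\<omega>. (if s < u \<and> u \<le> t then ennreal (drift_coeff law u (Z (max 0 u) \<omega>)) * ?h \<omega> else 0) \<partial>M)
      = (\<integral>\<^sup>+\<omega>. (if s < u \<and> u \<le> t \<and> u < \<tau> \<omega> then ?c \<omega> else 0) \<partial>M)"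
    proof (cases "s < u \<and> u \<le> t")
      case True
      then show ?thesis
        using nn_integral_drift_coeff_step[OF ts _ h, of u] s0 by (simp add: s_def max_def cong: if_cong)
    qed auto
  qed
  also have "\<dots> = (\<integral>\<^sup>+\<omega>. (\<integral>\<^sup>+u. (if s < u \<and> u \<le> t \<and> u < \<tau> \<omega> then ?c \<omega> else 0) \<partial>lborel) \<partial>M)"
    by (rule PL.Fubini'[symmetric]) measurable
  also have "\<dots> = (\<integral>\<^sup>+\<omega>. (if s < \<tau> \<omega> then ?c \<omega> * ennreal (min t (\<tau> \<omega>) - s) else 0) \<partial>M)"
    by (simp only: nn_integral_const_before[OF st])
  finally have E2: "(\<integral>\<^sup>+\<omega>. drift_integral s t \<omega> * ?h \<omega> \<partial>M) = \<dots>" .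
  have "(\<integral>\<^sup>+\<omega>. ennreal (1 - Z t \<omega>) * ?h \<omega> \<partial>M) + (\<integral>\<^sup>+\<omega>. drift_integral s t \<omega> * ?h \<omega> \<partial>M)
    = (\<integral>\<^sup>+\<omega>. (if t < \<tau> \<omega> then ennreal ((\<tau> \<omega> - t) / (\<tau> \<omega> - s)) * ennreal (1 - Z s \<omega>) * ?h \<omega> else 0)
        + (if s < \<tau> \<omega> then ?c \<omega> * ennreal (min t (\<tau> \<omega>) - s) else 0) \<partial>M)"
    unfolding E1 E2 by (rule nn_integral_add[symmetric]) measurable
  also have "\<dots> = (\<integral>\<^sup>+\<omega>. (if s < \<tau> \<omega> then ennreal (1 - Z s \<omega>) * ?h \<omega> else 0) \<partial>M)"
  proof (rule nn_integral_cong)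
    fix \<omega>
    consider "\<tau> \<omega> \<le> s" | "s < \<tau> \<omega>" "\<tau> \<omega> \<le> t" | "t < \<tau> \<omega>" by linarith
    then show "(if t < \<tau> \<omega> then ennreal ((\<tau> \<omega> - t) / (\<tau> \<omega> - s)) * ennreal (1 - Z s \<omega>) * ?h \<omega> else 0)
        + (if s < \<tau> \<omega> then ?c \<omega> * ennreal (min t (\<tau> \<omega>) - s) else 0)
      = (if s < \<tau> \<omega> then ennreal (1 - Z s \<omega>) * ?h \<omega> else 0)"
    proof cases
      case 1
      then show ?thesis using st by simp
    next
      case 2
      then have e: "ennreal (1 / (\<tau> \<omega> - s)) * ennreal (\<tau> \<omega> - s) = 1"
        by (simp add: ennreal_mult[symmetric])
      have "?c \<omega> * ennreal (\<tau> \<omega> - s)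
        = (ennreal (1 / (\<tau> \<omega> - s)) * ennreal (\<tau> \<omega> - s)) * (ennreal (1 - Z s \<omega>) * ?h \<omega>)"
        by (simp only: mult_ac)
      then have "?c \<omega> * ennreal (\<tau> \<omega> - s) = ennreal (1 - Z s \<omega>) * ?h \<omega>"
        unfolding e by simp
      then show ?thesis using 2 by (simp add: min_def)
    next
      case 3
      have "ennreal ((\<tau> \<omega> - t) / (\<tau> \<omega> - s)) + ennreal (1 / (\<tau> \<omega> - s)) * ennreal (t - s)
         = ennreal ((\<tau> \<omega> - t) / (\<tau> \<omega> - s) + 1 / (\<tau> \<omega> - s) * (t - s))"
        using 3 st by (simp add: ennreal_mult[symmetric] ennreal_plus)
      also have "(\<tau> \<omega> - t) / (\<tau> \<omega> - s) + 1 / (\<tau> \<omega> - s) * (t - s) = 1"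
        using 3 st by (simp add: add_divide_distrib[symmetric])
      finally have e: "ennreal ((\<tau> \<omega> - t) / (\<tau> \<omega> - s)) + ennreal (1 / (\<tau> \<omega> - s)) * ennreal (t - s) = 1" by simp
      have "ennreal ((\<tau> \<omega> - t) / (\<tau> \<omega> - s)) * ennreal (1 - Z s \<omega>) * ?h \<omega> + ?c \<omega> * ennreal (t - s)
        = (ennreal ((\<tau> \<omega> - t) / (\<tau> \<omega> - s)) + ennreal (1 / (\<tau> \<omega> - s)) * ennreal (t - s)) * (ennreal (1 - Z s \<omega>) * ?h \<omega>)"
        by (subst distrib_right) (simp only: mult_ac)
      then show ?thesis using 3 st by (simp add: e min_def)
    qed
  qed
  finally show ?thesis unfolding s_def[symmetric] before[of s] .
qed

section \<open>Finiteness and measurability of the integrated drift\<close>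

text \<open>The compensation identity for the trivial partition with \<open>n = 0\<close> and
  constant test function 1: the expected drift cannot exceed the expectation of 1 -
  \<open>Z 0\<close>, and the process starts at 0.\<close>

lemma nn_integral_drift_integral_le_1:
  assumes "0 \<le> t"
  shows "(\<integral>\<^sup>+\<omega>. drift_integral 0 t \<omega> \<partial>M) \<le> 1"
proof -
  have "(\<integral>\<^sup>+\<omega>. drift_integral 0 t \<omega> \<partial>M) \<le> (\<integral>\<^sup>+\<omega>. ennreal (1 - Z 0 \<omega>) \<partial>M)"
    using nn_integral_compensator[of "\<lambda>_. 0" 0 t "\<lambda>_. 1"] assms
    by (simp add: partition_def) (metis le_add2 add.commute le_iff_add)
  also have "\<dots> = (\<integral>\<^sup>+\<omega>. 1 \<partial>M)" by (intro nn_integral_cong) (simp add: Z_0)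
  also have "\<dots> = 1" by (simp add: emeasure_space_1)
  finally show ?thesis .
qed

text \<open>Finite expectation settles each integer horizon; monotonicity in t then gives one
  exceptional set for all times.\<close>

lemma AE_drift_integral_finite: "AE \<omega> in M. \<forall>t. drift_integral 0 t \<omega> < \<infinity>"
proof -
  have "AE \<omega> in M. drift_integral 0 (real k) \<omega> \<noteq> \<infinity>" for k
  proof (rule nn_integral_PInf_AE)
    show "(\<integral>\<^sup>+\<omega>. drift_integral 0 (real k) \<omega> \<partial>M) \<noteq> \<infinity>"
      using order.strict_trans1[OF nn_integral_drift_integral_le_1[of "real k"] ennreal_one_less_top] by simp
  qed measurable
  then have "AE \<omega> in M. \<forall>k. drift_integral 0 (real k) \<omega> \<noteq> \<infinity>"
    by (simp add: AE_all_countable)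
  then show ?thesis
  proof eventually_elim
    case (elim \<omega>)
    show ?case
    proof
      fix t
      obtain k where "t \<le> real k" using real_arch_simple by blast
      then have "drift_integral 0 t \<omega> \<le> drift_integral 0 (real k) \<omega>"
        unfolding drift_integral_def by (intro nn_integral_mono) auto
      then show "drift_integral 0 t \<omega> < \<infinity>" using elim[rule_format, of k]
        by (simp add: less_top order.strict_trans1)
    qed
  qed
qed

text \<open>At u = 0 the drift is 0 because the process starts at 0, outside the open unit interval.
  Hence the closed time interval of the theorem and the half-open one of
  \<open>drift_integral\<close> agree pointwise.\<close>

lemma drift_indicator_eq:
  assumes "\<omega> \<in> space M"
  shows "indicator {0..t} u *\<^sub>R drift law Z u \<omega> = (if 0 < u \<and> u \<le> t then drift_coeff law u (Z (max 0 u) \<omega>) else 0)"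
  using Z_0[OF assms] by (cases "u = 0") (auto simp: drift_eq_drift_coeff drift_coeff_def[of law 0] indicator_def)

lemma drift_path_measurable:
  assumes "\<omega> \<in> space M"
  shows "(\<lambda>u. if 0 < u \<and> u \<le> t then drift_coeff law u (Z (max 0 u) \<omega>) else 0) \<in> borel_measurable borel"
proof -
  have [measurable]: "(\<lambda>u. drift_coeff law u (Z (max 0 u) \<omega>)) \<in> borel_measurable borel"
    using measurable_compose[OF measurable_Pair2'[OF assms] drift_coeff_Z_measurable] by simp
  show ?thesis by measurable
qed

lemma nn_integral_drift_path:
  "(\<integral>\<^sup>+u. ennreal (if 0 < u \<and> u \<le> t then drift_coeff law u (Z (max 0 u) \<omega>) else 0) \<partial>lborel) = drift_integral 0 t \<omega>"
  unfolding drift_integral_def by (intro nn_integral_cong) simp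

lemma set_integrable_drift:
  assumes \<omega>: "\<omega> \<in> space M" and fin: "drift_integral 0 t \<omega> < \<infinity>"
  shows "set_integrable lborel {0..t} (\<lambda>u. drift law Z u \<omega>)"
  unfolding set_integrable_def drift_indicator_eq[OF \<omega>]
  using drift_path_measurable[OF \<omega>, of t] nn_integral_drift_path[of t \<omega>] fin
  by (intro integrableI_nonneg) (auto simp: law.drift_coeff_nonneg)

definition compensator :: "real \<Rightarrow> 'a \<Rightarrow> real" where
  "compensator t \<omega> = (\<integral>u\<in>{0..t}. drift law Z u \<omega> \<partial>lborel)"

lemma compensator_eq_drift_integral:
  assumes \<omega>: "\<omega> \<in> space M" and fin: "drift_integral 0 t \<omega> < \<infinity>"
  shows "ennreal (compensator t \<omega>) = drift_integral 0 t \<omega>"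
  using set_integrable_drift[OF assms] nn_integral_drift_path[of t \<omega>]
  unfolding set_integrable_def compensator_def set_lebesgue_integral_def drift_indicator_eq[OF \<omega>]
  by (subst nn_integral_eq_integral[symmetric]) (auto simp: law.drift_coeff_nonneg)

lemma compensator_nonneg: "\<omega> \<in> space M \<Longrightarrow> 0 \<le> compensator t \<omega>"
  unfolding compensator_def set_lebesgue_integral_def drift_indicator_eq
  by (intro integral_nonneg_AE AE_I2) (auto simp: law.drift_coeff_nonneg)

lemma drift_integral_add:
  assumes "\<omega> \<in> space M" "0 \<le> s" "s \<le> t"
  shows "drift_integral 0 t \<omega> = drift_integral 0 s \<omega> + drift_integral s t \<omega>"
proof -
  have [measurable]: "(\<lambda>u. drift_coeff law u (Z (max 0 u) \<omega>)) \<in> borel_measurable borel"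
    using measurable_compose[OF measurable_Pair2'[OF assms(1)] drift_coeff_Z_measurable] by simp
  show ?thesis unfolding drift_integral_def
    by (subst nn_integral_add[symmetric]) (use assms in \<open>auto intro!: nn_integral_cong\<close>)
qed

lemma AE_compensator_diff:
  assumes "0 \<le> s" "s \<le> t"
  shows "AE \<omega> in M. 0 \<le> compensator t \<omega> - compensator s \<omega>
    \<and> ennreal (compensator t \<omega> - compensator s \<omega>) = drift_integral s t \<omega>"
  using AE_drift_integral_finite AE_space
proof eventually_elim
  case (elim \<omega>)
  note eq = compensator_eq_drift_integral[OF elim(2) elim(1)[rule_format]]
  have add: "ennreal (compensator t \<omega>) = ennreal (compensator s \<omega>) + drift_integral s t \<omega>"
    unfolding eq by (rule drift_integral_add[OF elim(2) assms])
  then have "ennreal (compensator s \<omega>) \<le> ennreal (compensator t \<omega>)" by simp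
  then have le: "compensator s \<omega> \<le> compensator t \<omega>"
    using compensator_nonneg[OF elim(2), of t] by simp
  have "ennreal (compensator t \<omega> - compensator s \<omega>) = ennreal (compensator t \<omega>) - ennreal (compensator s \<omega>)"
    using compensator_nonneg[OF elim(2), of s] by (simp add: ennreal_minus)
  also have "\<dots> = drift_integral s t \<omega>"
    unfolding add by simp
  finally show ?case using le by simp
qed

text \<open>Stated for an arbitrary sigma-algebra that makes \<open>\<zeta>\<close> measurable up to time \<open>t\<close>, since it is needed
  both for the ambient one and for the filtration.\<close>
lemma compensator_measurable_wrt:
  assumes sp: "space Q = space M" and t: "0 \<le> t"
    and Zm: "\<And>s. 0 \<le> s \<Longrightarrow> s \<le> t \<Longrightarrow> Z s \<in> borel_measurable Q"
  shows "compensator t \<in> borel_measurable Q"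
proof -
  \<comment> \<open>The process is stopped at t, so that right-hand limits never look beyond t and
    only the variables measurable with respect to \<open>Q\<close> enter.\<close>
  have "(\<lambda>(s, \<omega>). (\<lambda>s. Z (min s t)) (max 0 s) \<omega>) \<in> borel_measurable (borel \<Otimes>\<^sub>M Q)"
  proof (rule right_continuous_jointly_measurable)
    show "Z (min s t) \<in> borel_measurable Q" if "0 \<le> s" for s using that t by (intro Zm) auto
    fix \<omega> s assume \<omega>: "\<omega> \<in> space Q" and s: "(0::real) \<le> s"
    show "continuous (at_right s) (\<lambda>s. Z (min s t) \<omega>)"
    proof (cases "s < t")
      case True
      have "eventually (\<lambda>u. u < t) (at_right s)" using True eventually_at_right by blast
      then have ev: "eventually (\<lambda>u. Z u \<omega> = Z (min u t) \<omega>) (at_right s)"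
        by eventually_elim simp
      have "((\<lambda>u. Z u \<omega>) \<longlongrightarrow> Z s \<omega>) (at_right s)"
        using Z_right_continuous[of \<omega> s] \<omega> s sp by (simp add: continuous_within)
      from Lim_transform_eventually[OF this ev] show ?thesis using True by (simp add: continuous_within)
    next
      case False
      have "eventually (\<lambda>u. Z t \<omega> = Z (min u t) \<omega>) (at_right s)"
        using eventually_at_right_less[of s] by eventually_elim (use False in simp)
      from Lim_transform_eventually[OF tendsto_const this] show ?thesis
        using False by (simp add: continuous_within min_absorb2)
    qed
  qed
  then have J: "(\<lambda>p. Z (min (max 0 (fst p)) t) (snd p)) \<in> borel_measurable (borel \<Otimes>\<^sub>M Q)"
    by (simp add: split_beta')
  have [measurable]: "(\<lambda>p. Z (min (max 0 (snd p)) t) (fst p)) \<in> borel_measurable (Q \<Otimes>\<^sub>M borel)"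
    using measurable_compose[OF _ J, of "\<lambda>p. (snd p, fst p)"] by simp
  have [measurable]: "(\<lambda>p. drift_coeff law (snd p) (Z (min (max 0 (snd p)) t) (fst p))) \<in> borel_measurable (Q \<Otimes>\<^sub>M borel)"
    using measurable_compose[OF _ law.borel_measurable_drift_coeff, of "\<lambda>p. (snd p, Z (min (max 0 (snd p)) t) (fst p))"] by simp
  have "(\<lambda>\<omega>. \<integral>u. (if 0 \<le> u \<and> u \<le> t then drift_coeff law u (Z (min (max 0 u) t) \<omega>) else 0) \<partial>lborel) \<in> borel_measurable Q"
    by (rule lborel.borel_measurable_lebesgue_integral) measurable
  also have "(\<lambda>\<omega>. \<integral>u. (if 0 \<le> u \<and> u \<le> t then drift_coeff law u (Z (min (max 0 u) t) \<omega>) else 0) \<partial>lborel) = compensator t"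
    unfolding compensator_def set_lebesgue_integral_def
    by (intro ext Bochner_Integration.integral_cong) (auto simp: drift_eq_drift_coeff indicator_def)
  finally show ?thesis .
qed

lemma compensator_measurable [measurable]: "0 \<le> t \<Longrightarrow> compensator t \<in> borel_measurable M"
  by (rule compensator_measurable_wrt) auto

lemma integrable_compensator:
  assumes t: "0 \<le> t"
  shows "integrable M (compensator t)"
proof (rule integrableI_nonneg)
  show "AE \<omega> in M. 0 \<le> compensator t \<omega>" using compensator_nonneg by auto
  have "(\<integral>\<^sup>+\<omega>. ennreal (compensator t \<omega>) \<partial>M) = (\<integral>\<^sup>+\<omega>. drift_integral 0 t \<omega> \<partial>M)"
    using AE_drift_integral_finite AE_space
    by (intro nn_integral_cong_AE) (auto elim!: eventually_elim2 simp: compensator_eq_drift_integral)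
  also have "\<dots> \<le> 1" by (rule nn_integral_drift_integral_le_1[OF t])
  finally show "(\<integral>\<^sup>+\<omega>. ennreal (compensator t \<omega>) \<partial>M) < \<infinity>"
    by (rule order.strict_trans1) simp
qed (use t in measurable)

lemma integrable_Z:
  assumes "0 \<le> t"
  shows "integrable M (Z t)"
proof (rule integrable_const_bound)
  show "AE \<omega> in M. norm (Z t \<omega>) \<le> 1" using AE_Z_bounds[OF assms] by eventually_elim simp
qed (use assms in measurable)

section \<open>The martingale property\<close>

definition compensated :: "real \<Rightarrow> 'a \<Rightarrow> real" where
  "compensated t \<omega> = Z t \<omega> - compensator t \<omega>"

lemma integrable_compensated: "0 \<le> t \<Longrightarrow> integrable M (compensated t)"
  unfolding compensated_def by (intro Bochner_Integration.integrable_diff integrable_Z integrable_compensator)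

text \<open>The indicator of the cylinder serves as test function in the compensation identity;
  integrability of all terms then allows a rearrangement into a statement about the compensated
  process.\<close>

lemma integral_cylinder:
  assumes ts: "partition ts n" "ts n = s" and st: "s \<le> t" and B: "\<And>i. B i \<in> sets borel"
    and E: "E = {\<omega>\<in>space M. \<forall>i\<le>n. Z (ts i) \<omega> \<in> B i}"
  shows "(\<integral>\<omega>\<in>E. (compensated t \<omega> - compensated s \<omega>) \<partial>M) = 0"
proof -
  have s0: "0 \<le> s" using partition_nonneg[OF ts(1), of n] ts(2) by simp
  then have t0: "0 \<le> t" using st by simp
  have [measurable]: "Z (ts i) \<in> borel_measurable M" if "i \<le> n" for i
    using partition_nonneg[OF ts(1) that] by simp
  have [measurable]: "E \<in> sets M"
  proof -
    have "E = (\<Inter>i\<in>{..n}. (Z (ts i) -` B i \<inter> space M))" unfolding E by auto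
    also have "\<dots> \<in> sets M" using B by (intro sets.finite_INT) auto
    finally show ?thesis .
  qed
  \<comment> \<open>Because the process starts at 0, its value at \<open>ts i\<close> is the sum of
    the first i increments, so the cylinder conditions become conditions on partial sums.\<close>
  define h :: "(nat \<Rightarrow> real) \<Rightarrow> ennreal" where "h x = indicator {x. \<forall>i\<in>{..n}. (\<Sum>k<i. x k) \<in> B i} x" for x
  have [measurable]: "h \<in> borel_measurable (PiM {..<n} (\<lambda>_. borel))"
  proof -
    have "(\<lambda>x. \<Sum>k<i. x k) \<in> borel_measurable (PiM {..<n} (\<lambda>_. borel :: real measure))" if "i \<in> {..n}" for i
      using that by (intro borel_measurable_sum measurable_component_singleton) auto
    then have "Measurable.pred (PiM {..<n} (\<lambda>_. borel :: real measure)) (\<lambda>x. \<forall>i\<in>{..n}. (\<Sum>k<i. x k) \<in> B i)"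
      by (intro pred_intros_finite pred_sets2[OF B]) auto
    then show ?thesis unfolding h_def by (intro borel_measurable_indicator') (auto simp: pred_def)
  qed
  have hE: "h (Z_increments ts n \<omega>) = indicator E \<omega>" if \<omega>: "\<omega> \<in> space M" for \<omega>
  proof -
    have "(\<Sum>k<i. Z_increments ts n \<omega> k) = Z (ts i) \<omega>" if "i \<le> n" for i
    proof -
      have "(\<Sum>k<i. Z_increments ts n \<omega> k) = (\<Sum>k<i. Z (ts (Suc k)) \<omega> - Z (ts k) \<omega>)"
        using that by (intro sum.cong) (auto simp: Z_increments_def)
      also have "\<dots> = Z (ts i) \<omega> - Z (ts 0) \<omega>" by (rule sum_lessThan_telescope)
      finally show ?thesis using ts(1) Z_0[OF \<omega>] by (simp add: partition_def)
    qed
    then show ?thesis using \<omega> by (auto simp: h_def E indicator_def)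
  qed
  have intE: "integrable M (\<lambda>\<omega>. indicator E \<omega> *\<^sub>R f \<omega>)" if "integrable M f" for f :: "'a \<Rightarrow> real"
    using that by (intro integrable_mult_indicator) auto
  have nZ: "(\<integral>\<^sup>+\<omega>. ennreal (1 - Z v \<omega>) * h (Z_increments ts n \<omega>) \<partial>M) = ennreal (\<integral>\<omega>\<in>E. (1 - Z v \<omega>) \<partial>M)" if v: "0 \<le> v" for v
  proof -
    have "(\<integral>\<^sup>+\<omega>. ennreal (1 - Z v \<omega>) * h (Z_increments ts n \<omega>) \<partial>M) = (\<integral>\<^sup>+\<omega>. ennreal (indicator E \<omega> *\<^sub>R (1 - Z v \<omega>)) \<partial>M)"
      by (intro nn_integral_cong) (auto simp: hE indicator_def)
    also have "\<dots> = ennreal (\<integral>\<omega>\<in>E. (1 - Z v \<omega>) \<partial>M)"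
      unfolding set_lebesgue_integral_def
    proof (rule nn_integral_eq_integral)
      show "integrable M (\<lambda>\<omega>. indicator E \<omega> *\<^sub>R (1 - Z v \<omega>))"
        using integrable_Z[OF v] by (intro intE) auto
      show "AE \<omega> in M. 0 \<le> indicator E \<omega> *\<^sub>R (1 - Z v \<omega>)"
        using AE_Z_bounds[OF v] by eventually_elim (simp add: indicator_def)
    qed
    finally show ?thesis .
  qed
  have Znn: "0 \<le> (\<integral>\<omega>\<in>E. (1 - Z v \<omega>) \<partial>M)" if v: "0 \<le> v" for v
    unfolding set_lebesgue_integral_def
  proof (rule integral_nonneg_AE)
    show "AE \<omega> in M. 0 \<le> indicator E \<omega> *\<^sub>R (1 - Z v \<omega>)"
      using AE_Z_bounds[OF v] by eventually_elim (simp add: indicator_def)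
  qed
  note diff = AE_compensator_diff[OF s0 st]
  have nC: "(\<integral>\<^sup>+\<omega>. drift_integral s t \<omega> * h (Z_increments ts n \<omega>) \<partial>M) = ennreal (\<integral>\<omega>\<in>E. (compensator t \<omega> - compensator s \<omega>) \<partial>M)"
  proof -
    have "(\<integral>\<^sup>+\<omega>. drift_integral s t \<omega> * h (Z_increments ts n \<omega>) \<partial>M)
       = (\<integral>\<^sup>+\<omega>. ennreal (indicator E \<omega> *\<^sub>R (compensator t \<omega> - compensator s \<omega>)) \<partial>M)"
    proof (rule nn_integral_cong_AE)
      show "AE \<omega> in M. drift_integral s t \<omega> * h (Z_increments ts n \<omega>)
          = ennreal (indicator E \<omega> *\<^sub>R (compensator t \<omega> - compensator s \<omega>))"
        using diff AE_space by eventually_elim (simp add: hE indicator_def)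
    qed
    also have "\<dots> = ennreal (\<integral>\<omega>\<in>E. (compensator t \<omega> - compensator s \<omega>) \<partial>M)"
      unfolding set_lebesgue_integral_def
    proof (rule nn_integral_eq_integral)
      show "integrable M (\<lambda>\<omega>. indicator E \<omega> *\<^sub>R (compensator t \<omega> - compensator s \<omega>))"
        using integrable_compensator[OF s0] integrable_compensator[OF t0] by (intro intE) auto
      show "AE \<omega> in M. 0 \<le> indicator E \<omega> *\<^sub>R (compensator t \<omega> - compensator s \<omega>)"
        using diff by eventually_elim (simp add: indicator_def)
    qed
    finally show ?thesis .
  qed
  have Cnn: "0 \<le> (\<integral>\<omega>\<in>E. (compensator t \<omega> - compensator s \<omega>) \<partial>M)"
    unfolding set_lebesgue_integral_def
  proof (rule integral_nonneg_AE)
    show "AE \<omega> in M. 0 \<le> indicator E \<omega> *\<^sub>R (compensator t \<omega> - compensator s \<omega>)"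
      using diff by eventually_elim (simp add: indicator_def)
  qed
  have "ennreal (\<integral>\<omega>\<in>E. (1 - Z t \<omega>) \<partial>M) + ennreal (\<integral>\<omega>\<in>E. (compensator t \<omega> - compensator s \<omega>) \<partial>M)
      = ennreal (\<integral>\<omega>\<in>E. (1 - Z s \<omega>) \<partial>M)"
    using nn_integral_compensator[OF ts(1), of t h] st ts(2) nC nZ[OF s0] nZ[OF t0] by simp
  \<comment> \<open>The three integrals are nonnegative reals, so the identity descends from
    \<open>ennreal\<close> to the reals, where terms may be subtracted.\<close>
  then have eq: "(\<integral>\<omega>\<in>E. (1 - Z t \<omega>) \<partial>M) + (\<integral>\<omega>\<in>E. (compensator t \<omega> - compensator s \<omega>) \<partial>M) = (\<integral>\<omega>\<in>E. (1 - Z s \<omega>) \<partial>M)"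
    using Znn[OF s0] Znn[OF t0] Cnn by (simp add: ennreal_plus[symmetric] del: ennreal_plus)
  have iZ: "set_integrable M E (\<lambda>\<omega>. 1 - Z v \<omega>)" if "0 \<le> v" for v
    unfolding set_integrable_def using integrable_Z[OF that] by (intro intE) auto
  have iC: "set_integrable M E (\<lambda>\<omega>. compensator t \<omega> - compensator s \<omega>)"
    unfolding set_integrable_def using integrable_compensator[OF s0] integrable_compensator[OF t0] by (intro intE) auto
  have "(\<integral>\<omega>\<in>E. (compensated t \<omega> - compensated s \<omega>) \<partial>M)
    = (\<integral>\<omega>\<in>E. ((1 - Z s \<omega>) - (1 - Z t \<omega>) - (compensator t \<omega> - compensator s \<omega>)) \<partial>M)"
    unfolding compensated_def by (intro set_lebesgue_integral_cong) auto
  also have "\<dots> = (\<integral>\<omega>\<in>E. (1 - Z s \<omega>) \<partial>M) - (\<integral>\<omega>\<in>E. (1 - Z t \<omega>) \<partial>M) - (\<integral>\<omega>\<in>E. (compensator t \<omega> - compensator s \<omega>) \<partial>M)"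
    using set_integral_diff(2)[OF set_integral_diff(1)[OF iZ[OF s0] iZ[OF t0]] iC]
      set_integral_diff(2)[OF iZ[OF s0] iZ[OF t0]] by simp
  finally show ?thesis using eq by simp
qed

section \<open>From cylinders to the completed filtration\<close>

text \<open>The times 0 and s are required in \<open>J\<close> so that sorting \<open>J\<close>
  yields a partition from 0 to the conditioning time s. The choice \<open>B j = UNIV\<close> makes
  such added times harmless.\<close>

definition cylinders :: "real \<Rightarrow> 'a set set" where
  "cylinders s = {E. \<exists>J B. finite J \<and> J \<subseteq> {0..s} \<and> 0 \<in> J \<and> s \<in> J \<and> (\<forall>j. B j \<in> sets borel)
      \<and> E = {\<omega>\<in>space M. \<forall>j\<in>J. Z j \<omega> \<in> B j}}"

lemma cylindersI:
  assumes "finite J" "J \<subseteq> {0..s}" "0 \<in> J" "s \<in> J" "\<And>j. B j \<in> sets borel" "E = {\<omega>\<in>space M. \<forall>j\<in>J. Z j \<omega> \<in> B j}"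
  shows "E \<in> cylinders s"
  using assms unfolding cylinders_def by blast

lemma cylinder_Int:
  assumes "E1 \<in> cylinders s" "E2 \<in> cylinders s"
  shows "E1 \<inter> E2 \<in> cylinders s"
proof -
  obtain J1 B1 where 1: "finite J1" "J1 \<subseteq> {0..s}" "0 \<in> J1" "s \<in> J1" "\<And>j. B1 j \<in> sets borel" "E1 = {\<omega>\<in>space M. \<forall>j\<in>J1. Z j \<omega> \<in> B1 j}"
    using assms(1) unfolding cylinders_def by blast
  obtain J2 B2 where 2: "finite J2" "J2 \<subseteq> {0..s}" "0 \<in> J2" "s \<in> J2" "\<And>j. B2 j \<in> sets borel" "E2 = {\<omega>\<in>space M. \<forall>j\<in>J2. Z j \<omega> \<in> B2 j}"
    using assms(2) unfolding cylinders_def by blast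
  show ?thesis
    by (rule cylindersI[of "J1 \<union> J2" s "\<lambda>j. (if j \<in> J1 then B1 j else UNIV) \<inter> (if j \<in> J2 then B2 j else UNIV)"])
      (use 1 2 in auto)
qed

lemma cylinder_measurable:
  assumes "E \<in> cylinders s"
  shows "E \<in> sets M"
proof -
  obtain J B where J: "finite J" "J \<subseteq> {0..s}" "0 \<in> J" "\<And>j. B j \<in> sets borel" "E = {\<omega>\<in>space M. \<forall>j\<in>J. Z j \<omega> \<in> B j}"
    using assms unfolding cylinders_def by blast
  have "E = (\<Inter>j\<in>J. (Z j -` B j \<inter> space M))" using J(3) unfolding J(5) by auto
  also have "\<dots> \<in> sets M" using J by (intro sets.finite_INT measurable_sets[OF Z_measurable]) auto
  finally show ?thesis .
qed

lemma integral_cylinders: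
  assumes "E \<in> cylinders s" "s \<le> t"
  shows "(\<integral>\<omega>\<in>E. (compensated t \<omega> - compensated s \<omega>) \<partial>M) = 0"
proof -
  obtain J B where J: "finite J" "J \<subseteq> {0..s}" "0 \<in> J" "s \<in> J" "\<And>j. B j \<in> sets borel" "E = {\<omega>\<in>space M. \<forall>j\<in>J. Z j \<omega> \<in> B j}"
    using assms(1) unfolding cylinders_def by blast
  obtain ts n where ts: "partition ts n" "ts n = s" "ts ` {..n} = J"
    using partition_of_finite_set[OF J(1-4)] .
  show ?thesis
    by (rule integral_cylinder[OF ts(1,2) assms(2), of "\<lambda>i. B (ts i)"]) (use J ts(3) in auto)
qed

lemma filtration_subset:
  assumes "0 \<le> s"
  shows "compl_nat_filtration M Z s \<subseteq> sigma_sets (space M) (cylinders s \<union> null_sets M)"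
  unfolding compl_nat_filtration_def
proof (rule sigma_sets_mono', rule Un_mono[OF _ order_refl], safe)
  fix u and B :: "real set" assume u: "u \<in> {0..s}" and B: "B \<in> sets borel"
  show "Z u -` B \<inter> space M \<in> cylinders s"
    by (rule cylindersI[of "{0, s, u}" s "\<lambda>j. if j = u then B else UNIV"]) (use u B assms in auto)
qed

text \<open>The sets with this property form a Dynkin system, and cylinders together with null sets
  are a generator stable under intersection. Measurability is carried along because complements and
  disjoint unions use additivity of the integral.\<close>

lemma integral_filtration:
  assumes s: "0 \<le> s" and st: "s \<le> t" and A: "A \<in> compl_nat_filtration M Z s"
  shows "A \<in> sets M \<and> (\<integral>\<omega>\<in>A. (compensated t \<omega> - compensated s \<omega>) \<partial>M) = 0"
proof -
  let ?f = "\<lambda>\<omega>. compensated t \<omega> - compensated s \<omega>"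
  have int: "integrable M ?f"
    using s st by (intro Bochner_Integration.integrable_diff integrable_compensated) auto
  have sint: "set_integrable M A ?f" if "A \<in> sets M" for A
    unfolding set_integrable_def using int that by (rule integrable_mult_indicator[rotated])
  have "space M \<in> cylinders s"
    by (rule cylindersI[of "{0, s}" s "\<lambda>_. UNIV"]) (use s in auto)
  \<comment> \<open>The whole space is itself a cylinder; its integral is what the complement step
    subtracts from.\<close>
  then have total: "(\<integral>\<omega>\<in>space M. ?f \<omega> \<partial>M) = 0" using st by (rule integral_cylinders)
  have "Int_stable (cylinders s \<union> null_sets M)"
  proof (rule Int_stableI)
    fix a b assume ab: "a \<in> cylinders s \<union> null_sets M" "b \<in> cylinders s \<union> null_sets M"
    then have "a \<in> sets M" "b \<in> sets M" using cylinder_measurable by auto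
    then show "a \<inter> b \<in> cylinders s \<union> null_sets M"
      using ab by (auto intro: cylinder_Int null_set_Int1 null_set_Int2)
  qed
  moreover have "cylinders s \<union> null_sets M \<subseteq> Pow (space M)"
    using sets.sets_into_space[OF cylinder_measurable] sets.sets_into_space[OF null_setsD2] by blast
  moreover have "A \<in> sigma_sets (space M) (cylinders s \<union> null_sets M)"
    using filtration_subset[OF s] A by blast
  ultimately show ?thesis
  proof (induction rule: sigma_sets_induct_disjoint)
    case (basic A)
    then show ?case
    proof
      assume "A \<in> cylinders s"
      then show ?case using st by (simp add: cylinder_measurable integral_cylinders)
    next
      assume A: "A \<in> null_sets M"
      then have "AE \<omega> in M. indicator A \<omega> *\<^sub>R ?f \<omega> = 0"
        using AE_not_in[OF A] by (auto elim!: eventually_mono)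
      then have "(\<integral>\<omega>\<in>A. ?f \<omega> \<partial>M) = 0"
        unfolding set_lebesgue_integral_def by (rule integral_eq_zero_AE)
      then show ?case using A by auto
    qed
  next
    case empty
    then show ?case by (simp add: set_lebesgue_integral_def)
  next
    case (compl A)
    have "(\<integral>\<omega>\<in>(space M - A) \<union> A. ?f \<omega> \<partial>M) = (\<integral>\<omega>\<in>space M - A. ?f \<omega> \<partial>M) + (\<integral>\<omega>\<in>A. ?f \<omega> \<partial>M)"
      using compl by (intro set_integral_Un sint) auto
    moreover have "(space M - A) \<union> A = space M" using compl sets.sets_into_space by blast
    ultimately show ?case using compl total sets.compl_sets[of A M] by simp
  next
    case (union A)
    have "(\<integral>\<omega>\<in>(\<Union>i. A i). ?f \<omega> \<partial>M) = (\<Sum>i. (\<integral>\<omega>\<in>A i. ?f \<omega> \<partial>M))"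
      using union by (intro lebesgue_integral_countable_add sint) (auto simp: disjoint_family_on_def)
    moreover have "(\<Union>i. A i) \<in> sets M" using union by (intro sets.countable_UN) auto
    ultimately show ?case using union by simp
  qed
qed

lemma compensated_adapted:
  assumes t: "0 \<le> t" and B: "B \<in> sets borel"
  shows "compensated t -` B \<inter> space M \<in> compl_nat_filtration M Z t"
proof -
  let ?g = "(\<Union>s\<in>{0..t}. {Z s -` B \<inter> space M | B. B \<in> sets borel}) \<union> null_sets M"
  \<comment> \<open>The filtration is a family of set systems; turning its member at time t into a
    measure space makes measurability of functions available.\<close>
  define Q where "Q = sigma (space M) ?g"
  have sub: "?g \<subseteq> Pow (space M)" using sets.sets_into_space[OF null_setsD2] by blast
  have sp: "space Q = space M" unfolding Q_def using sub by (rule space_measure_of)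
  have setsQ: "sets Q = compl_nat_filtration M Z t"
    unfolding Q_def compl_nat_filtration_def using sub by (rule sets_measure_of)
  have Zm: "Z s \<in> borel_measurable Q" if "0 \<le> s" "s \<le> t" for s
    by (rule measurableI) (use that in \<open>auto simp: sp setsQ compl_nat_filtration_def intro!: sigma_sets.Basic\<close>)
  have "compensated t \<in> borel_measurable Q"
    unfolding compensated_def
    using compensator_measurable_wrt[OF sp t Zm] Zm[OF t order_refl] by (intro borel_measurable_diff)
  from measurable_sets[OF this B] show ?thesis by (simp add: sp setsQ)
qed

theorem compensated_martingale: "martingale_wrt M (compl_nat_filtration M Z) compensated"
  unfolding martingale_wrt_def
proof (intro conjI allI impI ballI)
  fix s t A assume s: "0 \<le> s" and st: "s \<le> t" and A: "A \<in> compl_nat_filtration M Z s"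
  have AM: "A \<in> sets M" and 0: "(\<integral>\<omega>\<in>A. (compensated t \<omega> - compensated s \<omega>) \<partial>M) = 0"
    using integral_filtration[OF s st A] by auto
  have i: "set_integrable M A (compensated v)" if "0 \<le> v" for v
    unfolding set_integrable_def using integrable_compensated[OF that] AM by (rule integrable_mult_indicator[rotated])
  show "(\<integral>\<omega>\<in>A. compensated t \<omega> \<partial>M) = (\<integral>\<omega>\<in>A. compensated s \<omega> \<partial>M)"
    using set_integral_diff(2)[OF i i, of t s] 0 s st by simp
qed (auto intro: integrable_compensated compensated_adapted)

text \<open>The drift vanishes after \<tau> and \<open>zeta\<close> is stopped by construction, so
  this holds at every \<omega>.\<close>

lemma compensated_stopped: "compensated t \<omega> = compensated (min t (\<tau> \<omega>)) \<omega>"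
proof -
  have "compensator t \<omega> = compensator (min t (\<tau> \<omega>)) \<omega>"
    unfolding compensator_def set_lebesgue_integral_def
    by (intro Bochner_Integration.integral_cong)
      (auto simp: indicator_def drift_eq_drift_coeff drift_coeff_after_tau)
  moreover have "Z t \<omega> = Z (min t (\<tau> \<omega>)) \<omega>" by (simp add: zeta_def)
  ultimately show ?thesis by (simp add: compensated_def)
qed

end

theorem mainTheorem13:
  fixes M :: "'a measure" and g :: "real \<Rightarrow> 'a \<Rightarrow> real" and \<tau> :: "'a \<Rightarrow> real"
    and Z :: "real \<Rightarrow> 'a \<Rightarrow> real" and Ptau :: "real measure"
    and F :: "real \<Rightarrow> 'a set set" and N :: "real \<Rightarrow> 'a \<Rightarrow> real"
  assumes "prob_space M"
    and "complete_measure M"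
    and "standard_gamma_process M g"
    and "\<tau> \<in> borel_measurable M"
    and "\<forall>\<omega>\<in>space M. 0 < \<tau> \<omega>"
    and "prob_space.indep_set M
           (sigma_sets (space M) {\<tau> -` B \<inter> space M | B. B \<in> sets borel})
           (sigma_sets (space M) (\<Union>t\<in>{0..}. {g t -` B \<inter> space M | B. B \<in> sets borel}))"
  defines "Z \<equiv> zeta g \<tau>"
    and "Ptau \<equiv> distr M borel \<tau>"
    and "F \<equiv> compl_nat_filtration M Z"
    and "N \<equiv> (\<lambda>t \<omega>. Z t \<omega> - (\<integral>s\<in>{0..t}. drift Ptau Z s \<omega> \<partial>lborel))"
  shows "(AE \<omega> in M. \<forall>s\<ge>0. 0 < Z s \<omega> \<and> Z s \<omega> < 1 \<longrightarrow>
            set_integrable Ptau {s<..} (inner_integrand Ptau s (Z s \<omega>)))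
       \<and> (AE \<omega> in M. \<forall>t\<ge>0. set_integrable lborel {0..t} (\<lambda>s. drift Ptau Z s \<omega>))
       \<and> martingale_wrt M F N
       \<and> (AE \<omega> in M. \<forall>t\<ge>0. N t \<omega> = N (min t (\<tau> \<omega>)) \<omega>)"
proof -
  interpret gamma_bridge M g \<tau>
    using assms(1,3-6) by (simp add: gamma_bridge_def gamma_bridge_axioms_def)
  have N: "N = compensated"
    by (simp add: N_def Z_def Ptau_def compensated_def compensator_def fun_eq_iff)
  have "AE \<omega> in M. \<forall>s\<ge>0. 0 < Z s \<omega> \<and> Z s \<omega> < 1 \<longrightarrow> set_integrable Ptau {s<..} (inner_integrand Ptau s (Z s \<omega>))"
    using AE_space
  proof eventually_elim
    case (elim \<omega>)
    show ?case
    proof (intro allI impI)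
      fix s :: real assume s: "0 \<le> s" and z: "0 < Z s \<omega> \<and> Z s \<omega> < 1"
      \<comment> \<open>Integrability of the inner integrand is established for positive s; time 0
        is excluded because the process starts at 0, outside the open unit interval.\<close>
      then have "s \<noteq> 0" using Z_0[OF elim] by (auto simp: Z_def)
      then show "set_integrable Ptau {s<..} (inner_integrand Ptau s (Z s \<omega>))"
        unfolding Ptau_def using s z by (intro law.set_integrable_inner_integrand) auto
    qed
  qed
  moreover have "AE \<omega> in M. \<forall>t\<ge>0. set_integrable lborel {0..t} (\<lambda>s. drift Ptau Z s \<omega>)"
    using AE_drift_integral_finite AE_space
    by eventually_elim (simp add: Z_def Ptau_def set_integrable_drift)
  moreover have "martingale_wrt M F N"
    unfolding N F_def Z_def by (rule compensated_martingale)
  moreover have "AE \<omega> in M. \<forall>t\<ge>0. N t \<omega> = N (min t (\<tau> \<omega>)) \<omega>"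
    unfolding N using compensated_stopped by simp
  ultimately show ?thesis by blast
qed

end
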